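(* Let $k\geq 2$ be a fixed integer. Then, uniformly for integers $n\geq 1$ and real $u_1,\ldots,u_{k-1}\geq 0$ satisfying $u_1+\cdots+u_{k-1}\leq 1$, \[ \frac{1}{n!}\sum_{\sigma\in S_n}\frac{1}{\tau_k(\sigma)}\ \#\left\{(A_1,\ldots,A_k):\ [n]=A_1\sqcup\cdots\sqcup A_k,\ \sigma(A_i)=A_i\ (1\leq i\leq k),\ |A_i|\leq nu_i\ (1\leq i\leq k-1)\right\} = F(u_1,\ldots,u_{k-1})+O\!\left(n^{-1/k}\right), \] where the implied constant depends only on $k$.
   Context: $[n]=\{1,\ldots,n\}$; $S_n$ is the group of permutations of $[n]$; the tuples $(A_1,\ldots,A_k)$ are ordered tuples of (possibly empty) pairwise disjoint subsets with union $[n]$. For $\sigma\in S_n$, $c(\sigma)$ is the number of disjoint cycles of $\sigma$ and $\tau_k(\sigma)=k^{c(\sigma)}$. The function \[F(u_1,\ldots,u_{k-1})=\frac{1}{\Gamma(1/k)^k}\int_0^{u_1}\cdots\int_0^{u_{k-1}} t_1^{\frac1k-1}\cdots t_{k-1}^{\frac1k-1}(1-t_1-\cdots-t_{k-1})^{\frac1k-1}\,dt_1\cdots dt_{k-1}\] is the distribution function of $\mathrm{Dir}(\frac1k,\ldots,\frac1k)$. *)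

theory Defs
  imports "HOL-Analysis.Analysis" "HOL-Combinatorics.Orbits"
begin

text \<open>Fixed points count as cycles of length one, so the cycles of a permutation
  \<open>\<sigma>\<close> of \<open>{1..n}\<close> correspond to its distinct orbits on \<open>{1..n}\<close>.\<close>

definition num_cycles :: "nat \<Rightarrow> (nat \<Rightarrow> nat) \<Rightarrow> nat" where
  "num_cycles n \<sigma> = card (orbit \<sigma> ` {1..n})"

definition tau :: "nat \<Rightarrow> nat \<Rightarrow> (nat \<Rightarrow> nat) \<Rightarrow> nat" where
  "tau k n \<sigma> = k ^ num_cycles n \<sigma>"

text \<open>Tuples \<open>(A\<^sub>1, \<dots>, A\<^sub>k)\<close> are extensional functions on \<open>{1..k}\<close>, so that each tuple is
  counted once. Only \<open>u 1, \<dots>, u (k - 1)\<close> matter.\<close>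

definition invariant_tuples ::
    "nat \<Rightarrow> nat \<Rightarrow> (nat \<Rightarrow> real) \<Rightarrow> (nat \<Rightarrow> nat) \<Rightarrow> (nat \<Rightarrow> nat set) set" where
  "invariant_tuples k n u \<sigma> =
     {A \<in> {1..k} \<rightarrow>\<^sub>E Pow {1..n}.
        disjoint_family_on A {1..k} \<and> (\<Union>i\<in>{1..k}. A i) = {1..n} \<and>
        (\<forall>i\<in>{1..k}. \<sigma> ` A i = A i) \<and>
        (\<forall>i\<in>{1..<k}. real (card (A i)) \<le> real n * u i)}"

text \<open>Distribution function of \<open>Dir(1/k, \<dots>, 1/k)\<close>, as a Lebesgue integral over the box
  \<open>[0, u\<^sub>1] \<times> \<dots> \<times> [0, u\<^sub>k\<^sub>-\<^sub>1]\<close>. It is meant for \<open>u i \<ge> 0\<close> with \<open>\<Sum>i. u i \<le> 1\<close>: then all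
  bases below are nonnegative on the box, and they vanish only on a null set.\<close>

definition dirichlet_cdf :: "nat \<Rightarrow> (nat \<Rightarrow> real) \<Rightarrow> real" where
  "dirichlet_cdf k u =
     1 / Gamma (1 / real k) ^ k *
     (LINT t : (\<Pi>\<^sub>E i\<in>{1..<k}. {0..u i}) | (\<Pi>\<^sub>M i\<in>{1..<k}. lborel).
        (\<Prod>i\<in>{1..<k}. t i powr (1 / real k - 1)) *
        (1 - (\<Sum>i\<in>{1..<k}. t i)) powr (1 / real k - 1))"

end

theory Submission
  imports Defs
begin

text \<open>Put \<open>\<alpha> = 1/k\<close> and \<open>a(m) = \<alpha>(\<alpha>+1)\<dots>(\<alpha>+m-1)/m!\<close>. Summing \<open>\<alpha>\<close> to the number of cycles over the
  permutations that preserve a given partition, and then over the partitions, turns the left-hand side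
  into the sum of \<open>a(m\<^sub>1) \<dots> a(m\<^sub>k)\<close> over \<open>m\<^sub>1 + \<dots> + m\<^sub>k = n\<close> with \<open>m\<^sub>i \<le> n u\<^sub>i\<close> for \<open>i < k\<close>.

  The Dirichlet integral is cut into the cells \<open>m\<^sub>i \<le> n t\<^sub>i < m\<^sub>i + 1\<close>. For \<open>m \<ge> 1\<close> both \<open>a(m)\<close> and the
  integral of the density \<open>\<psi>(s) = s\<^sup>\<alpha>\<^sup>-\<^sup>1/\<Gamma>(\<alpha>)\<close> over \<open>[m, m+1]\<close> lie between \<open>\<psi>(m+1)\<close> and \<open>\<psi>(m)\<close>, so the
  error in a cell is at most a constant times \<open>a(m\<^sub>1) \<dots> a(m\<^sub>k)\<close> times the sum over \<open>i\<close> of \<open>1/(m\<^sub>i+1)\<close>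
  and of the indicators of the cells cut by the face \<open>t\<^sub>i = u\<^sub>i\<close>. By Vandermonde's
  identity, the sum of the products of the other \<open>k-1\<close> factors over \<open>\<Sum>\<^sub>l\<^sub>\<noteq>\<^sub>i m\<^sub>l = n-p\<close> has order
  \<open>(n-p+1)\<^sup>-\<^sup>\<alpha>\<close>, and convolving this with \<open>a(p)/(p+1)\<close>, or with \<open>a\<close> at a single \<open>p\<close>, gives
  \<open>O(n\<^sup>-\<^sup>\<alpha>)\<close>.\<close>

subsection \<open>Permutations preserving a partition\<close>

text \<open>Extensionality leaves one representative per tuple and makes the set finite when
  \<open>I\<close> is.\<close>

definition compositions :: "'i set \<Rightarrow> nat \<Rightarrow> ('i \<Rightarrow> nat) set" where
  "compositions I n = {m \<in> I \<rightarrow>\<^sub>E UNIV. sum m I = n}"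

lemma finite_compositions: "finite I \<Longrightarrow> finite (compositions I n)"
proof -
  assume I: "finite I"
  have "compositions I n \<subseteq> I \<rightarrow>\<^sub>E {..n}"
    using I by (auto simp: compositions_def PiE_iff extensional_def member_le_sum)
  then show ?thesis
    using I by (meson finite_PiE finite_atMost finite_subset)
qed

lemma compositions_empty: "compositions {} n = (if n = 0 then {\<lambda>_. undefined} else {})"
  by (auto simp: compositions_def)

lemma sum_compositions_insert:
  assumes "finite I" "i \<notin> I"
  shows "(\<Sum>m\<in>compositions (insert i I) n. G m)
       = (\<Sum>p\<le>n. \<Sum>m\<in>compositions I (n - p). G (m(i := p)))"
proof -
  have "(\<Sum>p\<le>n. \<Sum>m\<in>compositions I (n - p). G (m(i := p)))
      = (\<Sum>(p, m)\<in>Sigma {..n} (\<lambda>p. compositions I (n - p)). G (m(i := p)))"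
    using assms by (intro sum.Sigma) (auto simp: finite_compositions)
  also have "\<dots> = (\<Sum>m\<in>compositions (insert i I) n. G m)"
  \<comment> \<open>Splitting off coordinate \<open>i\<close> must reset it to
    \<open>undefined\<close>, because the remainder is extensional on \<open>I\<close>.\<close>
  proof (rule sum.reindex_bij_witness[where j = "\<lambda>(p, m). m(i := p)"
        and i = "\<lambda>m. (m i, m(i := undefined))"])
    fix x assume "x \<in> Sigma {..n} (\<lambda>p. compositions I (n - p))"
    moreover have "(\<Sum>j\<in>I. if j = i then p else m j) = sum m I" for p and m :: "'a \<Rightarrow> nat"
      using assms by (intro sum.cong) auto
    ultimately show "(case x of (p, m) \<Rightarrow> m(i := p)) \<in> compositions (insert i I) n"
      using assms by (auto simp: compositions_def PiE_iff extensional_def split: prod.splits)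
  next
    fix m assume "m \<in> compositions (insert i I) n"
    moreover have "(\<Sum>j\<in>I. if j = i then p else m j) = sum m I" for p
      using assms by (intro sum.cong) auto
    ultimately show "(m i, m(i := undefined)) \<in> Sigma {..n} (\<lambda>p. compositions I (n - p))"
      using assms by (auto simp: compositions_def PiE_iff extensional_def)
  qed (use assms in \<open>auto simp: compositions_def PiE_iff extensional_def split: prod.splits\<close>)
  finally show ?thesis ..
qed

lemma prod_fun_upd_other:
  "i \<notin> I \<Longrightarrow> (\<Prod>j\<in>I. g j (if j = i then p else m j)) = (\<Prod>j\<in>I. g j (m j))"
  by (rule prod.cong) auto

lemma sum_compositions_prod_insert:
  fixes g :: "'i \<Rightarrow> nat \<Rightarrow> real"
  assumes "finite I" "i \<notin> I"
  shows "(\<Sum>m\<in>compositions (insert i I) n. \<Prod>j\<in>insert i I. g j (m j))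
       = (\<Sum>p\<le>n. g i p * (\<Sum>m\<in>compositions I (n - p). \<Prod>j\<in>I. g j (m j)))"
  using assms by (simp add: sum_compositions_insert prod_fun_upd_other sum_distrib_left)

text \<open>The coefficient of \<open>x ^ m\<close> in the power series of
  \<open>(1 - x) powr (-\<beta>)\<close>; convolution therefore adds the parameters.\<close>

definition rising_ratio :: "real \<Rightarrow> nat \<Rightarrow> real" where
  "rising_ratio \<beta> m = pochhammer \<beta> m / fact m"

lemma rising_ratio_0 [simp]: "rising_ratio \<beta> 0 = 1"
  by (simp add: rising_ratio_def)

lemma rising_ratio_one [simp]: "rising_ratio 1 n = 1"
  by (simp add: rising_ratio_def pochhammer_fact[symmetric])

lemma rising_ratio_pos: "\<beta> > 0 \<Longrightarrow> rising_ratio \<beta> m > 0"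
  by (simp add: rising_ratio_def pochhammer_pos)

text \<open>The binomial theorem for rising factorials, divided by \<open>fact n\<close>.\<close>

lemma rising_ratio_vandermonde:
  "(\<Sum>p\<le>n. rising_ratio a p * rising_ratio b (n - p)) = rising_ratio (a + b) n"
proof -
  have "rising_ratio (a + b) n =
      (\<Sum>p\<le>n. of_nat (n choose p) * pochhammer a p * pochhammer b (n - p)) / fact n"
    by (simp add: rising_ratio_def pochhammer_binomial_sum)
  also have "\<dots> = (\<Sum>p\<le>n. rising_ratio a p * rising_ratio b (n - p))"
    unfolding sum_divide_distrib
    by (intro sum.cong) (auto simp: rising_ratio_def binomial_fact)
  finally show ?thesis ..
qed

text \<open>This is the power of the series with exponent \<open>card I\<close>. When
  \<open>card I * \<alpha> = 1\<close> the value is 1, so the products become probability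
  weights.\<close>

lemma sum_compositions_rising_ratio:
  assumes "finite I"
  shows "(\<Sum>m\<in>compositions I n. \<Prod>i\<in>I. rising_ratio \<alpha> (m i)) = rising_ratio (real (card I) * \<alpha>) n"
  using assms
proof (induction I arbitrary: n)
  case empty
  show ?case by (auto simp: compositions_empty rising_ratio_def pochhammer_0_left)
next
  case (insert i I)
  then show ?case
    using sum_compositions_prod_insert[OF insert.hyps, of "\<lambda>_. rising_ratio \<alpha>" n]
    by (simp add: rising_ratio_vandermonde ring_distribs)
qed

section \<open>Labelled set partitions and multinomial counting\<close>

definition set_partitions :: "'i set \<Rightarrow> 'a set \<Rightarrow> ('i \<Rightarrow> 'a set) set" where
  "set_partitions I S =
     {A \<in> I \<rightarrow>\<^sub>E Pow S. disjoint_family_on A I \<and> (\<Union>i\<in>I. A i) = S}"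

lemma finite_set_partitions: "finite I \<Longrightarrow> finite S \<Longrightarrow> finite (set_partitions I S)"
  unfolding set_partitions_def by (rule finite_subset[of _ "I \<rightarrow>\<^sub>E Pow S"]) (auto intro: finite_PiE)

lemma set_partitions_empty: "set_partitions {} S = (if S = {} then {\<lambda>_. undefined} else {})"
  by (auto simp: set_partitions_def disjoint_family_on_def)

lemma sum_set_partitions_insert:
  assumes "finite I" "i \<notin> I" "finite S"
  shows "(\<Sum>A\<in>set_partitions (insert i I) S. G A)
       = (\<Sum>B\<in>Pow S. \<Sum>A\<in>set_partitions I (S - B). G (A(i := B)))"
proof -
  have "(\<Sum>B\<in>Pow S. \<Sum>A\<in>set_partitions I (S - B). G (A(i := B)))
      = (\<Sum>(B, A)\<in>Sigma (Pow S) (\<lambda>B. set_partitions I (S - B)). G (A(i := B)))"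
    using assms by (intro sum.Sigma) (auto simp: finite_set_partitions)
  also have "\<dots> = (\<Sum>A\<in>set_partitions (insert i I) S. G A)"
  proof (rule sum.reindex_bij_witness[where j = "\<lambda>(B, A). A(i := B)"
        and i = "\<lambda>A. (A i, A(i := undefined))"])
    fix x assume x: "x \<in> Sigma (Pow S) (\<lambda>B. set_partitions I (S - B))"
    obtain B A where [simp]: "x = (B, A)" by fastforce
    have B: "B \<subseteq> S" and A: "A \<in> I \<rightarrow>\<^sub>E Pow (S - B)" and d: "disjoint_family_on A I"
      and un: "(\<Union>j\<in>I. A j) = S - B"
      using x by (auto simp: set_partitions_def)
    have neq: "j \<in> I \<Longrightarrow> j \<noteq> i" for j using assms by auto
    have "(\<Union>j\<in>I. (A(i := B)) j) = S - B"
      unfolding un[symmetric] using neq by auto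
    moreover have "disjoint_family_on (A(i := B)) (insert i I)"
      using d A neq unfolding disjoint_family_on_def by (auto simp: PiE_iff)
    moreover have "A(i := B) \<in> insert i I \<rightarrow>\<^sub>E Pow S"
      using A B by (auto simp: PiE_iff extensional_def)
    ultimately show "(case x of (B, A) \<Rightarrow> A(i := B)) \<in> set_partitions (insert i I) S"
      using B by (auto simp: set_partitions_def)
  next
    fix A assume "A \<in> set_partitions (insert i I) S"
    then have A: "A \<in> insert i I \<rightarrow>\<^sub>E Pow S" and d: "disjoint_family_on A (insert i I)"
      and un: "(\<Union>j\<in>insert i I. A j) = S"
      by (auto simp: set_partitions_def)
    have neq: "j \<in> I \<Longrightarrow> j \<noteq> i" for j using assms by auto
    have dj: "A j \<inter> A i = {}" if "j \<in> I" for j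
      using d neq[OF that] that by (auto simp: disjoint_family_on_def)
    have "(\<Union>j\<in>I. (A(i := undefined)) j) = (\<Union>j\<in>I. A j)"
      using neq by auto
    also have "\<dots> = S - A i"
      using un dj by auto
    finally have "(\<Union>j\<in>I. (A(i := undefined)) j) = S - A i" .
    moreover have "disjoint_family_on (A(i := undefined)) I"
      using d neq by (auto simp: disjoint_family_on_def)
    moreover have "A(i := undefined) \<in> I \<rightarrow>\<^sub>E Pow (S - A i)"
      using A dj neq by (auto simp: PiE_iff extensional_def)
    ultimately show "(A i, A(i := undefined)) \<in> Sigma (Pow S) (\<lambda>B. set_partitions I (S - B))"
      using A by (auto simp: set_partitions_def)
  qed (use assms in \<open>auto simp: set_partitions_def PiE_iff extensional_def fun_eq_iff
         split: prod.splits\<close>)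
  finally show ?thesis ..
qed

lemma sum_Pow_card:
  fixes h :: "nat \<Rightarrow> real"
  assumes "finite S"
  shows "(\<Sum>B\<in>Pow S. h (card B)) = (\<Sum>p\<le>card S. real (card S choose p) * h p)"
proof -
  have "(\<Sum>B\<in>Pow S. h (card B)) = (\<Sum>p\<le>card S. \<Sum>B | B \<in> Pow S \<and> card B = p. h (card B))"
    using assms by (intro sum.group[symmetric]) (auto simp: card_mono)
  also have "\<dots> = (\<Sum>p\<le>card S. real (card S choose p) * h p)"
    using assms by (intro sum.cong) (auto simp: n_subsets)
  finally show ?thesis .
qed

text \<open>Multinomial counting of the labelled partitions with given block sizes. The induction
  chooses the block of the new index first; only its size \<open>p\<close> matters, and
  \<open>n choose p\<close> times \<open>fact (n - p)\<close> is
  \<open>fact n / fact p\<close>.\<close>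

lemma sum_set_partitions:
  fixes g :: "'i \<Rightarrow> nat \<Rightarrow> real"
  assumes "finite I" "finite S"
  shows "(\<Sum>A\<in>set_partitions I S. \<Prod>i\<in>I. g i (card (A i)))
       = fact (card S) * (\<Sum>m\<in>compositions I (card S). \<Prod>i\<in>I. g i (m i) / fact (m i))"
  using assms
proof (induction I arbitrary: S)
  case empty
  then show ?case by (auto simp: set_partitions_empty compositions_empty)
next
  case (insert i I)
  define W where "W n = (\<Sum>m\<in>compositions I n. \<Prod>i\<in>I. g i (m i) / fact (m i))" for n
  have "(\<Sum>A\<in>set_partitions (insert i I) S. \<Prod>i\<in>insert i I. g i (card (A i)))
      = (\<Sum>B\<in>Pow S. g i (card B) *
            (\<Sum>A\<in>set_partitions I (S - B). \<Prod>j\<in>I. g j (card (A j))))"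
    using insert.hyps insert.prems
    by (simp add: sum_set_partitions_insert sum_distrib_left
        prod_fun_upd_other[where g = "\<lambda>j B. g j (card B)"])
  also have "\<dots> = (\<Sum>B\<in>Pow S. g i (card B) * (fact (card S - card B) * W (card S - card B)))"
  proof (rule sum.cong)
    fix B assume "B \<in> Pow S"
    then have "finite (S - B)" "card (S - B) = card S - card B"
      using insert.prems by (auto simp: card_Diff_subset finite_subset)
    then show "g i (card B) * (\<Sum>A\<in>set_partitions I (S - B). \<Prod>j\<in>I. g j (card (A j)))
        = g i (card B) * (fact (card S - card B) * W (card S - card B))"
      using insert.IH[of "S - B"] by (simp add: W_def)
  qed simp
  also have "\<dots> = (\<Sum>p\<le>card S. real (card S choose p) *
      (g i p * (fact (card S - p) * W (card S - p))))"
    by (rule sum_Pow_card[OF insert.prems])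
  also have "\<dots> = fact (card S) * (\<Sum>p\<le>card S. g i p / fact p * W (card S - p))"
    unfolding sum_distrib_left by (intro sum.cong) (auto simp: binomial_fact)
  also have "\<dots> = fact (card S) *
      (\<Sum>m\<in>compositions (insert i I) (card S). \<Prod>i\<in>insert i I. g i (m i) / fact (m i))"
    using sum_compositions_prod_insert[OF insert.hyps, of "\<lambda>i p. g i p / fact p"]
    by (simp add: W_def)
  finally show ?case .
qed

section \<open>Cycle counts and colour-preserving permutations\<close>

text \<open>Composing with the transposition inserts \<open>a\<close> into the cycle of
  \<open>b\<close>, immediately before \<open>b\<close>. Deleting \<open>a\<close> gives back the
  old cycle.\<close>

lemma orbit_transpose_Int:
  assumes p: "p permutes S" and a: "a \<notin> S" and b: "b \<in> S" and x: "x \<in> S"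
  shows "orbit (Transposition.transpose a b \<circ> p) x \<inter> S = orbit p x"
proof -
  let ?s = "Transposition.transpose a b \<circ> p"
  have pa: "p a = a" using p a by (simp add: permutes_not_in)
  have ps: "p y \<in> S" if "y \<in> S" for y using p that by (simp add: permutes_in_image)
  have sa: "?s a = b" using pa by simp
  have s: "?s y = (if p y = b then a else p y)" if "y \<in> S" for y
    using ps[OF that] a by (auto simp: Transposition.transpose_def)
  \<comment> \<open>The clause for \<open>y = a\<close> carries the induction through the detour:
    the point after \<open>a\<close> is \<open>b\<close>, which must already be known to lie in the
    old orbit.\<close>
  have fwd: "(y \<in> S \<longrightarrow> y \<in> orbit p x) \<and> (y = a \<longrightarrow> b \<in> orbit p x) \<and> y \<in> insert a S"
    if "y \<in> orbit ?s x" for y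
    using that
  proof induction
    case base
    have "p x \<in> orbit p x" by (rule orbit.base)
    then show ?case using s[OF x] ps[OF x] a by (auto split: if_splits)
  next
    case (step y)
    show ?case
    proof (cases "y = a")
      case True
      then show ?thesis using step sa a b by auto
    next
      case False
      then have y: "y \<in> S" "y \<in> orbit p x" using step by auto
      then have "p y \<in> orbit p x" by (auto intro: orbit.step)
      then show ?thesis using s[OF y(1)] ps[OF y(1)] a by (auto split: if_splits)
    qed
  qed
  \<comment> \<open>One step of \<open>p\<close> is one step of \<open>?s\<close>, or two when it
    lands on \<open>b\<close> and the path passes through \<open>a\<close>.\<close>
  have stp: "p y \<in> orbit ?s x" if "y \<in> S" "?s y \<in> orbit ?s x" for y
  proof (cases "p y = b")
    case True
    then have "?s y = a" using s that by simp
    then have "?s a \<in> orbit ?s x" using that(2) by (metis orbit.step)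
    then show ?thesis using sa True by simp
  next
    case False
    then show ?thesis using s that by simp
  qed
  have "y \<in> orbit ?s x \<and> y \<in> S" if "y \<in> orbit p x" for y
    using that
  proof induction
    case base
    show ?case using stp[OF x orbit.base] ps[OF x] by blast
  next
    case (step y)
    then show ?case using stp[OF _ orbit.step] ps by blast
  qed
  then show ?thesis using fwd by blast
qed

text \<open>\<open>a\<close> shares the cycle of \<open>b\<close>, so \<open>insert a S\<close> has
  no orbits beyond those of points of \<open>S\<close>; intersecting with \<open>S\<close> matches
  new orbits bijectively with old ones.\<close>

lemma card_orbits_insert_cycle:
  assumes p: "p permutes S" and S: "finite S" and a: "a \<notin> S" and b: "b \<in> S"
  shows "card (orbit (Transposition.transpose a b \<circ> p) ` insert a S) = card (orbit p ` S)"
proof -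
  let ?s = "Transposition.transpose a b \<circ> p"
  have "?s permutes insert a S"
    using p b by (intro permutes_compose[OF permutes_subset[OF p]] permutes_swap_id) auto
  then have perm: "permutation ?s" using S by (auto simp: permutation_permutes)
  have self: "y \<in> orbit ?s y" for y using permutation_self_in_orbit[OF perm] .
  have "?s a = b" using p a by (simp add: permutes_not_in)
  then have "b \<in> orbit ?s a" by (metis orbit.base)
  then have "orbit ?s a = orbit ?s b"
    using orbit_cyclic_eq3[OF cyclic_on_orbit'[OF perm]] by simp
  then have "orbit ?s ` insert a S = orbit ?s ` S" using b by auto
  moreover have "inj_on (\<lambda>X. X \<inter> S) (orbit ?s ` S)"
  proof (rule inj_onI, clarify)
    fix x y assume xy: "x \<in> S" "y \<in> S" and eq: "orbit ?s x \<inter> S = orbit ?s y \<inter> S"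
    have "y \<in> orbit ?s x" using self[of y] xy eq by blast
    then show "orbit ?s x = orbit ?s y"
      using orbit_cyclic_eq3[OF cyclic_on_orbit'[OF perm]] by simp
  qed
  moreover have "(\<lambda>X. X \<inter> S) ` orbit ?s ` S = orbit p ` S"
    unfolding image_image using orbit_transpose_Int[OF p a b] by (intro image_cong) auto
  ultimately show ?thesis by (metis card_image)
qed

text \<open>Orbits of points of \<open>S\<close> stay inside \<open>S\<close>, so the one through
  \<open>a\<close> is new.\<close>

lemma card_orbits_insert_fixpoint:
  assumes p: "p permutes S" and S: "finite S" and a: "a \<notin> S"
  shows "card (orbit p ` insert a S) = Suc (card (orbit p ` S))"
proof -
  have perm: "permutation p" using p S by (auto simp: permutation_permutes)
  have "orbit p x \<subseteq> S" if "x \<in> S" for x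
    by (rule permutes_orbit_subset[OF p that])
  moreover have "a \<in> orbit p a" by (rule permutation_self_in_orbit[OF perm])
  ultimately have "orbit p a \<notin> orbit p ` S" using a by blast
  then show ?thesis using S by simp
qed

text \<open>The Chinese restaurant construction: every permutation of \<open>insert a S\<close> is
  uniquely \<open>transpose a b \<circ> p\<close> with \<open>p\<close> permuting \<open>S\<close>,
  and it preserves colours exactly when \<open>p\<close> does and \<open>b\<close> has the colour of
  \<open>a\<close>. The choice \<open>b = a\<close> opens a cycle and contributes
  \<open>\<alpha>\<close>, every other admissible \<open>b\<close> contributes 1. The total
  \<open>\<alpha> + card B\<close> is the next factor of the Pochhammer symbol for that
  colour.\<close>

lemma sum_colour_preserving_permutations:
  fixes \<kappa> :: "'a \<Rightarrow> 'i" and \<alpha> :: real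
  assumes "finite S" "finite I" "\<kappa> ` S \<subseteq> I"
  shows "(\<Sum>p | p permutes S \<and> (\<forall>x\<in>S. \<kappa> (p x) = \<kappa> x). \<alpha> ^ card (orbit p ` S))
       = (\<Prod>i\<in>I. pochhammer \<alpha> (card {x \<in> S. \<kappa> x = i}))"
  using assms(1,3)
proof (induction S)
  case empty
  have "{p :: 'a \<Rightarrow> 'a. p permutes {} \<and> (\<forall>x\<in>{}. \<kappa> (p x) = \<kappa> x)} = {id}"
    by auto
  then show ?case by simp
next
  case (insert a S)
  define P where "P = {p. p permutes S \<and> (\<forall>x\<in>S. \<kappa> (p x) = \<kappa> x)}"
  define B where "B = {b \<in> S. \<kappa> b = \<kappa> a}"
  let ?f = "\<lambda>(b, p). Transposition.transpose a b \<circ> p"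
  have finP: "finite P" unfolding P_def
    by (rule finite_subset[OF _ finite_permutations[OF insert.hyps(1)]]) auto
  have finB: "finite B" "a \<notin> B" unfolding B_def using insert.hyps by auto
  have pa: "p a = a" if "p permutes S" for p using that insert.hyps by (simp add: permutes_not_in)
  have pS: "p x \<in> S" if "p permutes S" "x \<in> S" for p x using that by (simp add: permutes_in_image)
  \<comment> \<open>If \<open>b\<close> has the colour of \<open>a\<close>, the transposition itself
    preserves colours. Conversely, \<open>a\<close> is sent to \<open>b\<close>.\<close>
  have inv: "(\<forall>x\<in>insert a S. \<kappa> ((Transposition.transpose a b \<circ> p) x) = \<kappa> x)
      \<longleftrightarrow> \<kappa> b = \<kappa> a \<and> (\<forall>x\<in>S. \<kappa> (p x) = \<kappa> x)" if p: "p permutes S" for b p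
  proof -
    have "\<kappa> ((Transposition.transpose a b \<circ> p) x) = \<kappa> (p x)" if "\<kappa> b = \<kappa> a" for x
      using that by (auto simp: Transposition.transpose_def)
    moreover have "(Transposition.transpose a b \<circ> p) a = b" using pa[OF p] by simp
    ultimately show ?thesis by (metis insert_iff pa[OF p])
  qed
  have "{p. p permutes insert a S \<and> (\<forall>x\<in>insert a S. \<kappa> (p x) = \<kappa> x)} = ?f ` (insert a B \<times> P)"
    (is "?L = ?R")
  proof (intro equalityI subsetI)
    fix q assume q: "q \<in> ?L"
    then have "q \<in> ?f ` {(b, p). b \<in> insert a S \<and> p \<in> {p. p permutes S}}"
      using permutes_insert[of a S] by auto
    then obtain b p where bp: "b \<in> insert a S" "p permutes S" "q = Transposition.transpose a b \<circ> p" by auto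
    then show "q \<in> ?R" using q inv[OF bp(2), of b] by (auto simp: B_def P_def)
  next
    fix q assume "q \<in> ?R"
    then obtain b p where bp: "b \<in> insert a B" "p \<in> P" "q = Transposition.transpose a b \<circ> p" by auto
    then have "p permutes S" by (simp add: P_def)
    have "q \<in> ?f ` {(b, p). b \<in> insert a S \<and> p \<in> {p. p permutes S}}"
      using bp by (auto simp: B_def P_def)
    then have "q permutes insert a S" using permutes_insert[of a S] by auto
    then show "q \<in> ?L" using bp inv[OF \<open>p permutes S\<close>, of b] by (auto simp: B_def P_def)
  qed
  moreover have "inj_on ?f (insert a B \<times> P)"
  proof (rule inj_onI, clarify)
    fix b p c q assume *: "p \<in> P" "q \<in> P" "Transposition.transpose a b \<circ> p = Transposition.transpose a c \<circ> q"
    \<comment> \<open>Evaluating at \<open>a\<close>, which \<open>p\<close> and \<open>q\<close>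
      fix, recovers \<open>b\<close>; the transposition then cancels.\<close>
    then have "(Transposition.transpose a b \<circ> p) a = (Transposition.transpose a c \<circ> q) a" by simp
    moreover have "p a = a" "q a = a" using * pa by (auto simp: P_def)
    ultimately have "b = c" by simp
    moreover have "Transposition.transpose a b \<circ> (Transposition.transpose a b \<circ> p) = Transposition.transpose a b \<circ> (Transposition.transpose a c \<circ> q)"
      using * by simp
    ultimately show "b = c \<and> p = q" by (simp add: o_assoc)
  qed
  ultimately have "(\<Sum>p | p permutes insert a S \<and> (\<forall>x\<in>insert a S. \<kappa> (p x) = \<kappa> x).
        \<alpha> ^ card (orbit p ` insert a S))
      = (\<Sum>(b, p)\<in>insert a B \<times> P. \<alpha> ^ card (orbit (Transposition.transpose a b \<circ> p) ` insert a S))"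
    by (simp add: sum.reindex case_prod_unfold)
  also have "\<dots> = (\<Sum>b\<in>insert a B. \<Sum>p\<in>P. \<alpha> ^ card (orbit (Transposition.transpose a b \<circ> p) ` insert a S))"
    by (simp add: sum.cartesian_product)
  also have "\<dots> = (\<Sum>p\<in>P. \<alpha> * \<alpha> ^ card (orbit p ` S)) + (\<Sum>b\<in>B. \<Sum>p\<in>P. \<alpha> ^ card (orbit p ` S))"
  proof -
    have "card (orbit (Transposition.transpose a b \<circ> p) ` insert a S) = card (orbit p ` S)"
      if "b \<in> B" "p \<in> P" for b p
      using that card_orbits_insert_cycle insert.hyps by (auto simp: B_def P_def)
    moreover have "card (orbit (Transposition.transpose a a \<circ> p) ` insert a S) = Suc (card (orbit p ` S))"
      if "p \<in> P" for p
      using that card_orbits_insert_fixpoint insert.hyps by (auto simp: P_def)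
    ultimately show ?thesis using finB by simp
  qed
  also have "\<dots> = (\<alpha> + card B) * (\<Sum>p\<in>P. \<alpha> ^ card (orbit p ` S))"
    by (simp add: sum_distrib_left[symmetric] ring_distribs)
  also have "(\<Sum>p\<in>P. \<alpha> ^ card (orbit p ` S)) = (\<Prod>i\<in>I. pochhammer \<alpha> (card {x \<in> S. \<kappa> x = i}))"
    using insert.IH insert.prems by (simp add: P_def)
  also have "(\<alpha> + card B) * \<dots> = (\<Prod>i\<in>I. pochhammer \<alpha> (card {x \<in> insert a S. \<kappa> x = i}))"
  proof -
    have aI: "\<kappa> a \<in> I" using insert.prems by auto
    have 1: "{x \<in> insert a S. \<kappa> x = i} = {x \<in> S. \<kappa> x = i}" if "i \<noteq> \<kappa> a" for i
      using that by auto
    have 2: "{x \<in> insert a S. \<kappa> x = \<kappa> a} = insert a B" by (auto simp: B_def)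
    have 3: "pochhammer \<alpha> (card (insert a B)) = (\<alpha> + card B) * pochhammer \<alpha> (card B)"
      using finB by (simp add: pochhammer_rec')
    show ?thesis
      unfolding prod.remove[OF assms(2) aI] 2 3 B_def[symmetric]
      using prod.cong[of "I - {\<kappa> a}" "I - {\<kappa> a}" "\<lambda>i. pochhammer \<alpha> (card {x \<in> insert a S. \<kappa> x = i})"
          "\<lambda>i. pochhammer \<alpha> (card {x \<in> S. \<kappa> x = i})"] 1 by force
  qed
  finally show ?case .
qed

text \<open>Colour each point by the index of its block: invariance of all blocks is then
  preservation of colours.\<close>

lemma sum_invariant_permutations:
  fixes \<alpha> :: real
  assumes "finite S" "finite I" "A \<in> set_partitions I S"
  shows "(\<Sum>p | p permutes S \<and> (\<forall>i\<in>I. p ` A i = A i). \<alpha> ^ card (orbit p ` S))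
       = (\<Prod>i\<in>I. pochhammer \<alpha> (card (A i)))"
proof -
  have A: "A \<in> I \<rightarrow>\<^sub>E Pow S" "disjoint_family_on A I" "(\<Union>i\<in>I. A i) = S"
    using assms(3) by (auto simp: set_partitions_def)
  define \<kappa> where "\<kappa> x = (SOME i. i \<in> I \<and> x \<in> A i)" for x
  have \<kappa>: "\<kappa> x \<in> I \<and> x \<in> A (\<kappa> x)" if "x \<in> S" for x
    using someI_ex[of "\<lambda>i. i \<in> I \<and> x \<in> A i"] that A(3) unfolding \<kappa>_def by blast
  have \<kappa>_eq: "\<kappa> x = i \<longleftrightarrow> x \<in> A i" if "x \<in> S" "i \<in> I" for x i
    using \<kappa>[OF that(1)] A(2) that(2) unfolding disjoint_family_on_def by blast
  have cls: "{x \<in> S. \<kappa> x = i} = A i" if "i \<in> I" for i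
    using \<kappa>_eq that A(1) by (auto simp: PiE_iff)
  have "(\<forall>i\<in>I. p ` A i = A i) \<longleftrightarrow> (\<forall>x\<in>S. \<kappa> (p x) = \<kappa> x)" if p: "p permutes S" for p
  proof
    assume *: "\<forall>i\<in>I. p ` A i = A i"
    show "\<forall>x\<in>S. \<kappa> (p x) = \<kappa> x"
    proof
      fix x assume x: "x \<in> S"
      then have "p x \<in> A (\<kappa> x)" using * \<kappa> by blast
      then show "\<kappa> (p x) = \<kappa> x" using \<kappa>[OF x] \<kappa>_eq p x by (simp add: permutes_in_image)
    qed
  next
    assume *: "\<forall>x\<in>S. \<kappa> (p x) = \<kappa> x"
    show "\<forall>i\<in>I. p ` A i = A i"
    proof
      fix i assume i: "i \<in> I"
      \<comment> \<open>An injective self-map of a finite set is onto, so inclusion is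
        enough.\<close>
      have "finite (A i)" "A i \<subseteq> S" using i A(1) assms(1) by (auto simp: PiE_iff finite_subset)
      moreover have "p ` A i \<subseteq> A i"
        unfolding cls[OF i, symmetric] using * p by (auto simp: permutes_in_image)
      ultimately show "p ` A i = A i"
        using p by (metis endo_inj_surj inj_on_subset permutes_inj subset_UNIV)
    qed
  qed
  then have "{p. p permutes S \<and> (\<forall>i\<in>I. p ` A i = A i)}
      = {p. p permutes S \<and> (\<forall>x\<in>S. \<kappa> (p x) = \<kappa> x)}" by auto
  moreover have "\<kappa> ` S \<subseteq> I" using \<kappa> by auto
  ultimately show ?thesis
    using sum_colour_preserving_permutations[OF assms(1,2), of \<kappa> \<alpha>] cls by simp
qed

section \<open>The average as a sum over compositions\<close>

text \<open>Exchange the sums over permutations and tuples. The size restriction is absorbed into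
  the factors, as the value 0 where it fails, so that the summand stays a product over blocks and
  \<open>sum_set_partitions\<close> applies. Block \<open>k\<close> is unrestricted, hence the guard
  \<open>i < k\<close>.\<close>

lemma invariant_tuples_average:
  fixes k n :: nat and u :: "nat \<Rightarrow> real"
  shows "1 / fact n * (\<Sum>\<sigma> | \<sigma> permutes {1..n}.
           1 / real (tau k n \<sigma>) * real (card (invariant_tuples k n u \<sigma>)))
       = (\<Sum>m\<in>compositions {1..k} n. \<Prod>i\<in>{1..k}.
           if i < k \<and> real (m i) > real n * u i then 0 else rising_ratio (1 / real k) (m i))"
proof -
  let ?S = "{1..n}" and ?I = "{1..k}" and ?\<alpha> = "1 / real k"
  define g where "g i m = (if i < k \<and> real m > real n * u i then 0 else pochhammer ?\<alpha> m)" for i m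
  define P where "P = set_partitions ?I ?S"
  define ok where "ok A \<longleftrightarrow> (\<forall>i\<in>{1..<k}. real (card (A i)) \<le> real n * u i)" for A :: "nat \<Rightarrow> nat set"
  have finP: "finite P" unfolding P_def by (rule finite_set_partitions) auto
  have it: "invariant_tuples k n u \<sigma> = {A \<in> P. ok A \<and> (\<forall>i\<in>?I. \<sigma> ` A i = A i)}" for \<sigma>
    by (auto simp: invariant_tuples_def P_def set_partitions_def ok_def)
  \<comment> \<open>The weight \<open>1 / tau\<close> is \<open>1 / k\<close> to the number of
    cycles, and the count of tuples is unfolded into a sum of this constant.\<close>
  have "(\<Sum>\<sigma> | \<sigma> permutes ?S. 1 / real (tau k n \<sigma>) * real (card (invariant_tuples k n u \<sigma>)))
      = (\<Sum>\<sigma> | \<sigma> permutes ?S. \<Sum>A | A \<in> P \<and> ok A \<and> (\<forall>i\<in>?I. \<sigma> ` A i = A i).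
            ?\<alpha> ^ card (orbit \<sigma> ` ?S))"
    unfolding it by (simp add: tau_def num_cycles_def power_one_over field_simps)
  also have "\<dots> = (\<Sum>\<sigma> | \<sigma> permutes ?S. \<Sum>A | A \<in> {A \<in> P. ok A} \<and> (\<forall>i\<in>?I. \<sigma> ` A i = A i).
            ?\<alpha> ^ card (orbit \<sigma> ` ?S))"
    by (simp add: conj_assoc)
  also have "\<dots> = (\<Sum>A | A \<in> P \<and> ok A. \<Sum>\<sigma> | \<sigma> \<in> {\<sigma>. \<sigma> permutes ?S} \<and> (\<forall>i\<in>?I. \<sigma> ` A i = A i).
            ?\<alpha> ^ card (orbit \<sigma> ` ?S))"
    using finP by (intro sum.swap_restrict) (auto simp: finite_permutations)
  also have "\<dots> = (\<Sum>A | A \<in> P \<and> ok A. \<Prod>i\<in>?I. pochhammer ?\<alpha> (card (A i)))"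
  proof (rule sum.cong)
    fix A assume "A \<in> {A. A \<in> P \<and> ok A}"
    then show "(\<Sum>\<sigma> | \<sigma> \<in> {\<sigma>. \<sigma> permutes ?S} \<and> (\<forall>i\<in>?I. \<sigma> ` A i = A i). ?\<alpha> ^ card (orbit \<sigma> ` ?S))
        = (\<Prod>i\<in>?I. pochhammer ?\<alpha> (card (A i)))"
      using sum_invariant_permutations[of ?S ?I A ?\<alpha>] by (simp add: P_def)
  qed simp
  also have "\<dots> = (\<Sum>A\<in>P. if ok A then \<Prod>i\<in>?I. pochhammer ?\<alpha> (card (A i)) else 0)"
    using finP by (rule sum.inter_filter)
  also have "\<dots> = (\<Sum>A\<in>P. \<Prod>i\<in>?I. g i (card (A i)))"
  proof (rule sum.cong)
    fix A
    show "(if ok A then \<Prod>i\<in>?I. pochhammer ?\<alpha> (card (A i)) else 0) = (\<Prod>i\<in>?I. g i (card (A i)))"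
    proof (cases "ok A")
      case True
      then have "g i (card (A i)) = pochhammer ?\<alpha> (card (A i))" if "i \<in> ?I" for i
        using that by (force simp: ok_def g_def)
      then show ?thesis using True by simp
    next
      case False
      then obtain i where "i \<in> {1..<k}" "real (card (A i)) > real n * u i"
        by (auto simp: ok_def not_le)
      then have "i \<in> ?I" "g i (card (A i)) = 0" by (auto simp: g_def)
      then have "(\<Prod>i\<in>?I. g i (card (A i))) = 0" by (intro prod_zero) auto
      then show ?thesis using False by simp
    qed
  qed simp
  also have "\<dots> = fact n * (\<Sum>m\<in>compositions ?I n. \<Prod>i\<in>?I. g i (m i) / fact (m i))"
    unfolding P_def by (subst sum_set_partitions) auto
  also have "(\<Sum>m\<in>compositions ?I n. \<Prod>i\<in>?I. g i (m i) / fact (m i))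
      = (\<Sum>m\<in>compositions ?I n. \<Prod>i\<in>?I.
           if i < k \<and> real (m i) > real n * u i then 0 else rising_ratio ?\<alpha> (m i))"
    by (intro sum.cong prod.cong) (auto simp: g_def rising_ratio_def)
  finally show ?thesis by simp
qed

subsection \<open>The rising factorial ratio\<close>

definition power_density :: "real \<Rightarrow> real \<Rightarrow> real" where
  "power_density \<alpha> s = s powr (\<alpha> - 1) / Gamma \<alpha>"

lemma power_density_nonneg: "\<alpha> > 0 \<Longrightarrow> power_density \<alpha> s \<ge> 0"
  by (simp add: power_density_def Gamma_real_pos less_imp_le)

lemma power_density_antimono:
  assumes "0 < \<alpha>" "\<alpha> \<le> 1" "0 < x" "x \<le> y"
  shows "power_density \<alpha> y \<le> power_density \<alpha> x"
  unfolding power_density_def using assms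
  by (intro divide_right_mono powr_mono2') (auto simp: Gamma_real_pos less_imp_le)

text \<open>The exact ratio is \<open>(y / x) powr (1 - \<alpha>)\<close>, where the base is at
  least 1 and the exponent at most 1.\<close>

lemma power_density_ratio:
  assumes "0 < \<alpha>" "\<alpha> \<le> 1" "0 < x" "x \<le> y"
  shows "power_density \<alpha> x \<le> y / x * power_density \<alpha> y"
proof -
  have "(y / x) powr (1 - \<alpha>) \<le> (y / x) powr 1"
    using assms by (intro powr_mono) auto
  then have "(y / x) powr (1 - \<alpha>) * y powr (\<alpha> - 1) \<le> y / x * y powr (\<alpha> - 1)"
    using assms by (intro mult_right_mono) auto
  moreover have "(y / x) powr (1 - \<alpha>) * y powr (\<alpha> - 1) = x powr (\<alpha> - 1)"
    using assms by (simp add: powr_divide powr_diff)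
  ultimately have "x powr (\<alpha> - 1) / Gamma \<alpha> \<le> y / x * y powr (\<alpha> - 1) / Gamma \<alpha>"
    using assms by (intro divide_right_mono) (auto simp: Gamma_real_pos less_imp_le)
  then show ?thesis by (simp add: power_density_def)
qed

lemma power_density_le_mult:
  assumes "0 < \<alpha>" "\<alpha> \<le> 1" "0 < x" "x \<le> y" "y \<le> c * x"
  shows "power_density \<alpha> x \<le> c * power_density \<alpha> y"
proof -
  have "y / x * power_density \<alpha> y \<le> c * power_density \<alpha> y"
    using assms by (intro mult_right_mono power_density_nonneg) (auto simp: field_simps)
  then show ?thesis using power_density_ratio[OF assms(1-4)] by simp
qed

text \<open>This plays the role of a derivative bound; comparability of \<open>x\<close> and
  \<open>y\<close> allows the larger argument in the denominator.\<close>

lemma power_density_diff: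
  assumes "0 < \<alpha>" "\<alpha> \<le> 1" "0 < x" "x \<le> y" "y \<le> c * x"
  shows "power_density \<alpha> x - power_density \<alpha> y \<le> c * (y - x) * (power_density \<alpha> y / y)"
proof -
  have "power_density \<alpha> x - power_density \<alpha> y \<le> (y / x - 1) * power_density \<alpha> y"
    using power_density_ratio[OF assms(1-4)] by (simp add: algebra_simps)
  also have "(y / x - 1) \<le> c * (y - x) / y"
  proof -
    have "y / x - 1 = (y - x) * (1 / x)" using assms by (simp add: field_simps)
    also have "\<dots> \<le> (y - x) * (c / y)"
      using assms by (intro mult_left_mono) (auto simp: field_simps)
    finally show ?thesis by (simp add: mult.commute)
  qed
  then have "(y / x - 1) * power_density \<alpha> y \<le> c * (y - x) / y * power_density \<alpha> y"
    using assms by (intro mult_right_mono power_density_nonneg) auto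
  finally show ?thesis by simp
qed

section \<open>Gamma quotients compared with powers\<close>

lemma rising_ratio_Gamma:
  assumes "\<beta> > 0"
  shows "rising_ratio \<beta> m = Gamma (real m + \<beta>) / Gamma (real m + 1) / Gamma \<beta>"
proof -
  have "\<beta> \<notin> \<int>\<^sub>\<le>\<^sub>0" using assms by (auto elim!: nonpos_Ints_cases)
  then show ?thesis
    by (simp add: rising_ratio_def pochhammer_Gamma Gamma_fact[symmetric] add.commute)
qed

lemma ln_Gamma_plus1: "(x::real) > 0 \<Longrightarrow> ln (Gamma (x + 1)) = ln x + ln (Gamma x)"
  using Gamma_real_pos[of x] by (subst Gamma_plus1) (auto simp: ln_mult_pos elim!: nonpos_Ints_cases)

text \<open>Gautschi's inequality, from the log-convexity of the Gamma function.\<close>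

lemma rising_ratio_le_power_density:
  assumes \<beta>: "0 < \<beta>" "\<beta> \<le> 1" and m: "m \<ge> 1"
  shows "rising_ratio \<beta> m \<le> power_density \<beta> (real m)"
proof -
  let ?m = "real m"
  have m0: "?m > 0" using m by simp
  \<comment> \<open>The point \<open>m + \<beta>\<close> divides \<open>[m, m + 1]\<close> with
    weights \<open>1 - \<beta>\<close> and \<open>\<beta>\<close>.\<close>
  have "(ln \<circ> Gamma) ((1 - \<beta>) *\<^sub>R ?m + \<beta> *\<^sub>R (?m + 1))
      \<le> (1 - \<beta>) * (ln \<circ> Gamma) ?m + \<beta> * (ln \<circ> Gamma) (?m + 1)"
    using \<beta> m0 by (intro convex_onD[OF log_convex_Gamma_real]) auto
  moreover have "(1 - \<beta>) *\<^sub>R ?m + \<beta> *\<^sub>R (?m + 1) = ?m + \<beta>" by (simp add: algebra_simps)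
  ultimately have "ln (Gamma (?m + \<beta>)) \<le> (1 - \<beta>) * ln (Gamma ?m) + \<beta> * ln (Gamma (?m + 1))"
    by simp
  then have "ln (Gamma (?m + \<beta>)) \<le> ln (Gamma (?m + 1)) + (\<beta> - 1) * ln ?m"
    unfolding ln_Gamma_plus1[OF m0] by (simp add: algebra_simps)
  also have "\<dots> = ln (Gamma (?m + 1) * ?m powr (\<beta> - 1))"
    using m0 by (subst ln_mult_pos) (auto simp: Gamma_real_pos ln_powr)
  finally have "Gamma (?m + \<beta>) \<le> Gamma (?m + 1) * ?m powr (\<beta> - 1)"
    using m0 \<beta> by (subst (asm) ln_le_cancel_iff) (auto simp: Gamma_real_pos)
  then have "Gamma (?m + \<beta>) / Gamma (?m + 1) \<le> ?m powr (\<beta> - 1)"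
    using m0 by (simp add: Gamma_real_pos divide_le_eq mult.commute)
  then show ?thesis
    unfolding rising_ratio_Gamma[OF \<beta>(1)] power_density_def
    using \<beta> by (intro divide_right_mono) (auto simp: Gamma_real_pos less_imp_le)
qed

text \<open>The other half: now \<open>m + 1\<close> is interpolated between
  \<open>m + \<beta>\<close> and \<open>m + \<beta> + 1\<close>. This yields a power of
  \<open>m + \<beta>\<close>, which is weakened to one of \<open>m + 1\<close>.\<close>

lemma power_density_le_rising_ratio:
  assumes \<beta>: "0 < \<beta>" "\<beta> \<le> 1"
  shows "power_density \<beta> (real m + 1) \<le> rising_ratio \<beta> m"
proof -
  let ?m = "real m"
  have mb: "?m + \<beta> > 0" using \<beta> by simp
  have "(ln \<circ> Gamma) ((1 - (1 - \<beta>)) *\<^sub>R (?m + \<beta>) + (1 - \<beta>) *\<^sub>R (?m + \<beta> + 1))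
      \<le> (1 - (1 - \<beta>)) * (ln \<circ> Gamma) (?m + \<beta>) + (1 - \<beta>) * (ln \<circ> Gamma) (?m + \<beta> + 1)"
    using \<beta> mb by (intro convex_onD[OF log_convex_Gamma_real]) auto
  moreover have "(1 - (1 - \<beta>)) *\<^sub>R (?m + \<beta>) + (1 - \<beta>) *\<^sub>R (?m + \<beta> + 1) = ?m + 1"
    by (simp add: algebra_simps)
  ultimately have "ln (Gamma (?m + 1))
      \<le> \<beta> * ln (Gamma (?m + \<beta>)) + (1 - \<beta>) * ln (Gamma (?m + \<beta> + 1))"
    by simp
  then have "ln (Gamma (?m + 1)) \<le> ln (Gamma (?m + \<beta>)) + (1 - \<beta>) * ln (?m + \<beta>)"
    unfolding ln_Gamma_plus1[OF mb] by (simp add: algebra_simps)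
  also have "(1 - \<beta>) * ln (?m + \<beta>) \<le> (1 - \<beta>) * ln (?m + 1)"
    using \<beta> mb by (intro mult_left_mono) auto
  finally have "ln (Gamma (?m + 1)) + (\<beta> - 1) * ln (?m + 1) \<le> ln (Gamma (?m + \<beta>))"
    by (simp add: algebra_simps)
  moreover have "ln (Gamma (?m + 1)) + (\<beta> - 1) * ln (?m + 1)
      = ln (Gamma (?m + 1) * (?m + 1) powr (\<beta> - 1))"
    by (subst ln_mult_pos) (auto simp: Gamma_real_pos ln_powr add_nonneg_pos)
  ultimately have "Gamma (?m + 1) * (?m + 1) powr (\<beta> - 1) \<le> Gamma (?m + \<beta>)"
    using mb by (metis Gamma_real_pos add_nonneg_pos ln_le_cancel_iff mult_pos_pos of_nat_0_le_iff
        powr_gt_zero zero_less_one less_numeral_extra(3))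
  then have "(?m + 1) powr (\<beta> - 1) \<le> Gamma (?m + \<beta>) / Gamma (?m + 1)"
    by (simp add: Gamma_real_pos le_divide_eq mult.commute add_nonneg_pos)
  then show ?thesis
    unfolding rising_ratio_Gamma[OF \<beta>(1)] power_density_def
    using \<beta> by (intro divide_right_mono) (auto simp: Gamma_real_pos less_imp_le)
qed

text \<open>The argument \<open>m + 1\<close> admits \<open>m = 0\<close>, which accounts for the
  summand 1; the factor 2 pays for the shift from \<open>m\<close> to \<open>m + 1\<close> when
  \<open>m \<ge> 1\<close>.\<close>

lemma rising_ratio_le_powr:
  assumes \<beta>: "0 < \<beta>" "\<beta> \<le> 1"
  shows "rising_ratio \<beta> m \<le> (1 + 2 / Gamma \<beta>) * (real m + 1) powr (\<beta> - 1)"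
proof (cases "m = 0")
  case True
  then show ?thesis using \<beta> by (simp add: Gamma_real_pos less_imp_le)
next
  case False
  then have "rising_ratio \<beta> m \<le> power_density \<beta> (real m)"
    using \<beta> by (intro rising_ratio_le_power_density) auto
  also have "\<dots> \<le> 2 * power_density \<beta> (real m + 1)"
    using False \<beta> by (intro power_density_le_mult) auto
  also have "\<dots> = (2 / Gamma \<beta>) * (real m + 1) powr (\<beta> - 1)" by (simp add: power_density_def)
  also have "\<dots> \<le> (1 + 2 / Gamma \<beta>) * (real m + 1) powr (\<beta> - 1)"
    by (intro mult_right_mono) auto
  finally show ?thesis .
qed

section \<open>Convolution bounds of order n to the power -\<alpha>\<close>

lemma powr_add_le_twice:
  fixes x y \<alpha> :: real
  assumes "0 \<le> x" "x \<le> y" "0 \<le> \<alpha>" "\<alpha> \<le> 1"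
  shows "(x + y) powr \<alpha> \<le> 2 * y powr \<alpha>"
proof -
  have "(x + y) powr \<alpha> \<le> (2 * y) powr \<alpha>" using assms by (intro powr_mono2) auto
  also have "\<dots> = 2 powr \<alpha> * y powr \<alpha>" using assms by (simp add: powr_mult)
  also have "\<dots> \<le> 2 powr 1 * y powr \<alpha>" using assms by (intro mult_right_mono powr_mono) auto
  finally show ?thesis by simp
qed

text \<open>Meant for \<open>x = p + 1\<close> and \<open>y = n - p + 1\<close>: the convolution
  summand, scaled up by the expected decay, is dominated by summable terms in \<open>p\<close> and
  in \<open>n - p\<close>. The larger of \<open>x\<close> and \<open>y\<close> absorbs the power of
  \<open>x + y\<close>, and \<open>\<alpha> \<le> 1/2\<close> makes the remaining total exponent
  \<open>\<alpha> - 2\<close> at most \<open>-1 - \<alpha>\<close>.\<close>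

lemma powr_summand_bound:
  fixes x y \<alpha> :: real
  assumes xy: "x \<ge> 1" "y \<ge> 1" and \<alpha>: "0 < \<alpha>" "\<alpha> \<le> 1/2"
  shows "(x + y) powr \<alpha> * (x powr (\<alpha> - 2) * y powr (-\<alpha>)) \<le> 2 * (x powr (-1-\<alpha>) + y powr (-1-\<alpha>))"
proof (cases "x \<le> y")
  case True
  have "(x + y) powr \<alpha> * (x powr (\<alpha> - 2) * y powr (-\<alpha>))
      \<le> (2 * y powr \<alpha>) * (x powr (\<alpha> - 2) * y powr (-\<alpha>))"
    using True assms by (intro mult_right_mono powr_add_le_twice) auto
  also have "\<dots> = 2 * x powr (\<alpha> - 2)" using xy by (simp add: powr_minus)
  also have "\<dots> \<le> 2 * x powr (-1-\<alpha>)" using assms by (intro mult_left_mono powr_mono) auto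
  finally show ?thesis by (smt (verit) powr_ge_zero)
next
  case False
  have "(x + y) powr \<alpha> * (x powr (\<alpha> - 2) * y powr (-\<alpha>))
      \<le> (2 * x powr \<alpha>) * (x powr (\<alpha> - 2) * y powr (-\<alpha>))"
    using False assms powr_add_le_twice[of y x \<alpha>] by (intro mult_right_mono) (auto simp: add.commute)
  also have "\<dots> = 2 * (x powr (2 * \<alpha> - 2) * y powr (-\<alpha>))"
    using xy by (simp add: powr_add[symmetric])
  also have "\<dots> \<le> 2 * (x powr (-1) * y powr (-\<alpha>))"
    using assms by (intro mult_left_mono mult_right_mono powr_mono) auto
  \<comment> \<open>As \<open>y < x\<close>, the factor \<open>x powr (-1)\<close> may be traded for
    \<open>y powr (-1)\<close>.\<close>
  also have "\<dots> \<le> 2 * (y powr (-1) * y powr (-\<alpha>))"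
    using assms False by (intro mult_left_mono mult_right_mono powr_mono2') auto
  also have "\<dots> = 2 * y powr (-1-\<alpha>)" unfolding powr_add[symmetric] by simp
  finally show ?thesis by (smt (verit) powr_ge_zero)
qed

text \<open>The analogue for a single term, where boundedness suffices: once the power of
  \<open>x + y\<close> is absorbed, no positive exponent remains, by
  \<open>\<alpha> \<le> 1/2\<close>.\<close>

lemma powr_product_bound:
  fixes x y \<alpha> :: real
  assumes xy: "x \<ge> 1" "y \<ge> 1" and \<alpha>: "0 < \<alpha>" "\<alpha> \<le> 1/2"
  shows "(x + y) powr \<alpha> * (x powr (\<alpha> - 1) * y powr (-\<alpha>)) \<le> 2"
proof (cases "x \<le> y")
  case True
  have "(x + y) powr \<alpha> * (x powr (\<alpha> - 1) * y powr (-\<alpha>))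
      \<le> (2 * y powr \<alpha>) * (x powr (\<alpha> - 1) * y powr (-\<alpha>))"
    using True assms by (intro mult_right_mono powr_add_le_twice) auto
  also have "\<dots> = 2 * x powr (\<alpha> - 1)" using xy by (simp add: powr_minus)
  also have "\<dots> \<le> 2 * x powr 0" using assms by (intro mult_left_mono powr_mono) auto
  finally show ?thesis using xy by simp
next
  case False
  have "(x + y) powr \<alpha> * (x powr (\<alpha> - 1) * y powr (-\<alpha>))
      \<le> (2 * x powr \<alpha>) * (x powr (\<alpha> - 1) * y powr (-\<alpha>))"
    using False assms powr_add_le_twice[of y x \<alpha>] by (intro mult_right_mono) (auto simp: add.commute)
  also have "\<dots> = 2 * (x powr (2 * \<alpha> - 1) * y powr (-\<alpha>))"
    using xy by (simp add: powr_add[symmetric])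
  also have "\<dots> \<le> 2 * (x powr 0 * y powr 0)"
    using assms by (intro mult_left_mono mult_mono powr_mono) auto
  finally show ?thesis using xy by simp
qed

text \<open>For \<open>\<alpha> = 1 / k\<close>, the parameter \<open>1 - \<alpha>\<close> belongs
  to the other \<open>k - 1\<close> coordinates together. The first bound serves the cell at a face,
  where one value of \<open>p\<close> matters; the second serves the discretisation error
  \<open>1 / (p + 1)\<close>.\<close>

lemma rising_ratio_product_bound:
  assumes \<alpha>: "0 < \<alpha>" "\<alpha> \<le> 1/2"
  obtains C where "C \<ge> 0" and "\<And>n p. p \<le> n \<Longrightarrow>
    rising_ratio \<alpha> p * rising_ratio (1 - \<alpha>) (n - p) \<le> C * (real n + 1) powr (-\<alpha>)"
    and "\<And>n. (\<Sum>p\<le>n. rising_ratio \<alpha> p / (real p + 1) * rising_ratio (1 - \<alpha>) (n - p))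
           \<le> C * (real n + 1) powr (-\<alpha>)"
proof -
  define K where "K = (1 + 2 / Gamma \<alpha>) * (1 + 2 / Gamma (1 - \<alpha>))"
  have K: "K \<ge> 0" unfolding K_def using \<alpha> by (simp add: Gamma_real_pos less_imp_le)
  \<comment> \<open>The series converges because \<open>1 + \<alpha> > 1\<close>; it bounds the sums
    in \<open>p\<close> and in \<open>n - p\<close> uniformly in \<open>n\<close>.\<close>
  define Z where "Z = (\<Sum>j. real (Suc j) powr (-1-\<alpha>))"
  have summ: "summable (\<lambda>j. real (Suc j) powr (-1-\<alpha>))"
    using \<alpha> by (subst summable_Suc_iff) (simp add: summable_real_powr_iff)
  have Z: "Z \<ge> 0" unfolding Z_def by (intro suminf_nonneg summ) auto
  have prod: "rising_ratio \<alpha> p * rising_ratio (1 - \<alpha>) q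
      \<le> K * ((real p + 1) powr (\<alpha> - 1) * (real q + 1) powr (-\<alpha>))" for p q
  proof -
    have "rising_ratio \<alpha> p * rising_ratio (1 - \<alpha>) q
      \<le> ((1 + 2 / Gamma \<alpha>) * (real p + 1) powr (\<alpha> - 1)) *
         ((1 + 2 / Gamma (1 - \<alpha>)) * (real q + 1) powr (1 - \<alpha> - 1))"
      using \<alpha> rising_ratio_pos[of \<alpha> p] rising_ratio_pos[of "1 - \<alpha>" q]
      by (intro mult_mono rising_ratio_le_powr) (auto simp: Gamma_real_pos less_imp_le)
    then show ?thesis by (simp add: K_def mult_ac)
  qed
  \<comment> \<open>Both bounds are proved after multiplication by
    \<open>(real n + 1) powr \<alpha>\<close>.\<close>
  have scale: "t \<le> c * (real n + 1) powr (-\<alpha>)" if "(real n + 1) powr \<alpha> * t \<le> c" for t c n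
    using that by (simp add: powr_minus field_simps)
  have nxy: "(real n + 1) powr \<alpha> \<le> ((real p + 1) + (real (n - p) + 1)) powr \<alpha>" if "p \<le> n" for n p
    using that \<alpha> by (intro powr_mono2) auto
  show ?thesis
  \<comment> \<open>\<open>2 * K\<close> comes from \<open>powr_product_bound\<close>,
    \<open>4 * K * Z\<close> from the two sums produced by
    \<open>powr_summand_bound\<close>.\<close>
  proof (rule that[of "2 * K + 4 * K * Z"])
    show "2 * K + 4 * K * Z \<ge> 0" using K Z by simp
  next
    fix n p :: nat assume p: "p \<le> n"
    let ?x = "real p + 1" and ?y = "real (n - p) + 1"
    have "(real n + 1) powr \<alpha> * (rising_ratio \<alpha> p * rising_ratio (1 - \<alpha>) (n - p))
        \<le> (?x + ?y) powr \<alpha> * (K * (?x powr (\<alpha> - 1) * ?y powr (-\<alpha>)))"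
      using rising_ratio_pos[of \<alpha> p] rising_ratio_pos[of "1 - \<alpha>" "n - p"] \<alpha>
      by (intro mult_mono[OF nxy[OF p] prod]) auto
    also have "\<dots> = K * ((?x + ?y) powr \<alpha> * (?x powr (\<alpha> - 1) * ?y powr (-\<alpha>)))" by simp
    also have "\<dots> \<le> K * 2" using K \<alpha> by (intro mult_left_mono powr_product_bound) auto
    also have "\<dots> \<le> 2 * K + 4 * K * Z" using K Z by simp
    finally show "rising_ratio \<alpha> p * rising_ratio (1 - \<alpha>) (n - p)
        \<le> (2 * K + 4 * K * Z) * (real n + 1) powr (-\<alpha>)"
      by (rule scale)
  next
    fix n :: nat
    let ?t = "\<lambda>p. rising_ratio \<alpha> p / (real p + 1) * rising_ratio (1 - \<alpha>) (n - p)"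
    have "(real n + 1) powr \<alpha> * ?t p
        \<le> 2 * K * (real (Suc p) powr (-1-\<alpha>) + real (Suc (n - p)) powr (-1-\<alpha>))" if p: "p \<le> n" for p
    proof -
      let ?x = "real p + 1" and ?y = "real (n - p) + 1"
      have "?t p = rising_ratio \<alpha> p * rising_ratio (1 - \<alpha>) (n - p) / ?x" by simp
      also have "\<dots> \<le> K * (?x powr (\<alpha> - 1) * ?y powr (-\<alpha>)) / ?x"
        using prod[of p "n - p"] by (intro divide_right_mono) auto
      also have "\<dots> = K * (?x powr (\<alpha> - 2) * ?y powr (-\<alpha>))"
      proof -
        have "?x powr (\<alpha> - 1) / ?x = ?x powr (\<alpha> - 1) / ?x powr 1" by simp
        also have "\<dots> = ?x powr (\<alpha> - 2)" unfolding powr_diff[symmetric] by simp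
        finally have "?x powr (\<alpha> - 1) / ?x = ?x powr (\<alpha> - 2)" .
        then show ?thesis by (metis times_divide_eq_left times_divide_eq_right mult.commute)
      qed
      finally have le: "?t p \<le> K * (?x powr (\<alpha> - 2) * ?y powr (-\<alpha>))" .
      have "(real n + 1) powr \<alpha> * ?t p
          \<le> (?x + ?y) powr \<alpha> * (K * (?x powr (\<alpha> - 2) * ?y powr (-\<alpha>)))"
        using rising_ratio_pos[of \<alpha> p] rising_ratio_pos[of "1 - \<alpha>" "n - p"] \<alpha>
        by (intro mult_mono[OF nxy[OF p] le]) auto
      also have "\<dots> = K * ((?x + ?y) powr \<alpha> * (?x powr (\<alpha> - 2) * ?y powr (-\<alpha>)))" by simp
      also have "\<dots> \<le> K * (2 * (?x powr (-1-\<alpha>) + ?y powr (-1-\<alpha>)))"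
        using K \<alpha> by (intro mult_left_mono powr_summand_bound) auto
      finally show ?thesis by (simp add: add.commute mult_ac)
    qed
    then have "(real n + 1) powr \<alpha> * (\<Sum>p\<le>n. ?t p)
        \<le> (\<Sum>p\<le>n. 2 * K * (real (Suc p) powr (-1-\<alpha>) + real (Suc (n - p)) powr (-1-\<alpha>)))"
      unfolding sum_distrib_left by (intro sum_mono) auto
    also have "\<dots> = 2 * K * ((\<Sum>p\<le>n. real (Suc p) powr (-1-\<alpha>)) + (\<Sum>p\<le>n. real (Suc (n - p)) powr (-1-\<alpha>)))"
      by (simp only: sum_distrib_left[symmetric] sum.distrib)
    also have "(\<Sum>p\<le>n. real (Suc (n - p)) powr (-1-\<alpha>)) = (\<Sum>p\<le>n. real (Suc p) powr (-1-\<alpha>))"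
      by (rule sum.reindex_bij_witness[where i = "\<lambda>p. n - p" and j = "\<lambda>p. n - p"]) auto
    also have "2 * K * ((\<Sum>p\<le>n. real (Suc p) powr (-1-\<alpha>)) + (\<Sum>p\<le>n. real (Suc p) powr (-1-\<alpha>)))
        \<le> 2 * K * (Z + Z)"
      unfolding Z_def using K summ by (intro mult_left_mono add_mono sum_le_suminf) auto
    also have "\<dots> \<le> 2 * K + 4 * K * Z" using K by simp
    finally show "(\<Sum>p\<le>n. ?t p) \<le> (2 * K + 4 * K * Z) * (real n + 1) powr (-\<alpha>)"
      by (rule scale)
  qed
qed

subsection \<open>Masses of one-dimensional cells\<close>

lemma measurable_power_density [measurable]:
  "power_density \<alpha> \<in> borel_measurable borel"
  unfolding power_density_def by measurable

text \<open>Truncation at \<open>v\<close> makes the cells with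
  \<open>p \<le> nat \<lfloor>real n * v\<rfloor>\<close> tile \<open>[0, v]\<close> exactly when
  \<open>n > 0\<close>.\<close>

definition cell :: "nat \<Rightarrow> real \<Rightarrow> nat \<Rightarrow> real set" where
  "cell n v p = {t. t \<le> v \<and> real p \<le> real n * t \<and> real n * t < real p + 1}"

lemma sets_cell [measurable]: "cell n v p \<in> sets borel"
  unfolding cell_def by measurable

text \<open>The leading factor \<open>n\<close> is the Jacobian of \<open>s = n * t\<close>. Values
  in \<open>ennreal\<close> spare integrability arguments at the singularity.\<close>

definition cell_density :: "real \<Rightarrow> nat \<Rightarrow> real \<Rightarrow> nat \<Rightarrow> real \<Rightarrow> ennreal" where
  "cell_density \<alpha> n v p t =
     indicator (cell n v p) t * ennreal (real n * power_density \<alpha> (real n * t))"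

lemma measurable_cell_density [measurable]:
  "cell_density \<alpha> n v p \<in> borel_measurable borel"
  unfolding cell_density_def by measurable

definition cell_mass :: "real \<Rightarrow> nat \<Rightarrow> real \<Rightarrow> nat \<Rightarrow> ennreal" where
  "cell_mass \<alpha> n v p = (\<integral>\<^sup>+ t. cell_density \<alpha> n v p t \<partial>lborel)"

lemma cell_mass_rescaled:
  assumes "n > 0"
  shows "cell_mass \<alpha> n v p =
    (\<integral>\<^sup>+ s. indicator ({real p..<real p + 1} \<inter> {..real n * v}) s * ennreal (power_density \<alpha> s) \<partial>lborel)"
    (is "_ = (\<integral>\<^sup>+ s. ?f s \<partial>lborel)")
proof -
  have "(\<integral>\<^sup>+ s. ?f s \<partial>lborel) = ennreal (real n) * (\<integral>\<^sup>+ t. ?f (real n * t) \<partial>lborel)"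
    using nn_integral_real_affine[of ?f "real n" 0] assms by simp
  also have "\<dots> = (\<integral>\<^sup>+ t. ennreal (real n) * ?f (real n * t) \<partial>lborel)"
    by (rule nn_integral_cmult[symmetric]) measurable
  also have "\<dots> = cell_mass \<alpha> n v p"
    unfolding cell_mass_def cell_density_def
    using assms by (intro nn_integral_cong)
      (auto simp: cell_def indicator_def ennreal_mult')
  finally show ?thesis ..
qed

text \<open>The singularity at 0 is integrable; the mass equals
  \<open>1 / Gamma (\<alpha> + 1)\<close>.\<close>

lemma nn_integral_power_density_unit:
  assumes "0 < \<alpha>"
  shows "(\<integral>\<^sup>+ s. indicator {0..1} s * ennreal (power_density \<alpha> s) \<partial>lborel) = ennreal (1 / (\<alpha> * Gamma \<alpha>))"
proof -
  have "((\<lambda>s. s powr (\<alpha> - 1) / Gamma \<alpha>) has_integral (1 powr (\<alpha> - 1 + 1) / (\<alpha> - 1 + 1)) / Gamma \<alpha>) {0..1}"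
    using assms by (intro has_integral_divide has_integral_powr_from_0) auto
  then have "(power_density \<alpha> has_integral (1 / (\<alpha> * Gamma \<alpha>))) {0..1}"
    by (simp add: power_density_def[abs_def])
  from nn_integral_has_integral_lebesgue[OF _ this] show ?thesis
    using assms by (simp add: power_density_nonneg ennreal_mult' ennreal_indicator[symmetric] ennreal_mult''
        mult.commute)
qed

lemma cell_mass_le_power_density:
  assumes "n > 0" "0 < \<alpha>" "\<alpha> \<le> 1" "p \<ge> 1"
  shows "cell_mass \<alpha> n v p \<le> ennreal (power_density \<alpha> (real p))"
proof -
  have "cell_mass \<alpha> n v p \<le> (\<integral>\<^sup>+ s. ennreal (power_density \<alpha> (real p)) * indicator {real p..<real p + 1} s \<partial>lborel)"
    unfolding cell_mass_rescaled[OF assms(1)]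
    using assms by (intro nn_integral_mono)
      (auto simp: indicator_def intro!: ennreal_leI power_density_antimono)
  also have "\<dots> = ennreal (power_density \<alpha> (real p))"
    by (simp add: nn_integral_cmult_indicator)
  finally show ?thesis .
qed

text \<open>The last hypothesis says that the cell is not truncated by \<open>v\<close>.\<close>

lemma power_density_le_cell_mass:
  assumes "n > 0" "0 < \<alpha>" "\<alpha> \<le> 1" "p \<ge> 1" "real p + 1 \<le> real n * v"
  shows "ennreal (power_density \<alpha> (real p + 1)) \<le> cell_mass \<alpha> n v p"
proof -
  have "ennreal (power_density \<alpha> (real p + 1))
      = (\<integral>\<^sup>+ s. ennreal (power_density \<alpha> (real p + 1)) * indicator {real p..<real p + 1} s \<partial>lborel)"
    by (simp add: nn_integral_cmult_indicator)
  also have "\<dots> \<le> cell_mass \<alpha> n v p"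
    unfolding cell_mass_rescaled[OF assms(1)]
    using assms by (intro nn_integral_mono)
      (auto simp: indicator_def intro!: ennreal_leI power_density_antimono)
  finally show ?thesis .
qed

text \<open>The constant adds up two cases: \<open>1 / (\<alpha> * Gamma \<alpha>)\<close> is the
  mass at the singularity, for \<open>p = 0\<close>, and 2 pays for passing from \<open>p\<close> to
  \<open>p + 1\<close> in the density.\<close>

lemma cell_mass_le:
  assumes "n > 0" "0 < \<alpha>" "\<alpha> \<le> 1"
  shows "cell_mass \<alpha> n v p \<le> ennreal ((2 + 1 / (\<alpha> * Gamma \<alpha>)) * rising_ratio \<alpha> p)"
proof (cases "p = 0")
  case True
  have "cell_mass \<alpha> n v p \<le> (\<integral>\<^sup>+ s. indicator {0..1} s * ennreal (power_density \<alpha> s) \<partial>lborel)"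
    unfolding cell_mass_rescaled[OF assms(1)] True
    by (intro nn_integral_mono) (auto simp: indicator_def)
  also have "\<dots> = ennreal (1 / (\<alpha> * Gamma \<alpha>))"
    by (rule nn_integral_power_density_unit[OF assms(2)])
  also have "\<dots> \<le> ennreal ((2 + 1 / (\<alpha> * Gamma \<alpha>)) * rising_ratio \<alpha> p)"
    using True by (intro ennreal_leI) simp
  finally show ?thesis .
next
  case False
  then have "cell_mass \<alpha> n v p \<le> ennreal (power_density \<alpha> (real p))"
    using assms by (intro cell_mass_le_power_density) auto
  also have "power_density \<alpha> (real p) \<le> 2 * power_density \<alpha> (real p + 1)"
    using False assms by (intro power_density_le_mult) auto
  also have "\<dots> \<le> 2 * rising_ratio \<alpha> p"
    using assms by (intro mult_left_mono power_density_le_rising_ratio) auto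
  also have "\<dots> \<le> (2 + 1 / (\<alpha> * Gamma \<alpha>)) * rising_ratio \<alpha> p"
    using assms rising_ratio_pos[of \<alpha> p] Gamma_real_pos[of \<alpha>] by (intro mult_right_mono) auto
  finally show ?thesis by (simp add: ennreal_leI)
qed

lemma cell_mass_real:
  assumes "n > 0" "0 < \<alpha>" "\<alpha> \<le> 1"
  shows "cell_mass \<alpha> n v p = ennreal (enn2real (cell_mass \<alpha> n v p))"
    and "enn2real (cell_mass \<alpha> n v p) \<le> (2 + 1 / (\<alpha> * Gamma \<alpha>)) * rising_ratio \<alpha> p"
proof -
  note le = cell_mass_le[OF assms, of v p]
  have "cell_mass \<alpha> n v p < \<infinity>"
    using le ennreal_less_top order.strict_trans1 by (metis infinity_ennreal_def)
  then show "cell_mass \<alpha> n v p = ennreal (enn2real (cell_mass \<alpha> n v p))" by simp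
  show "enn2real (cell_mass \<alpha> n v p) \<le> (2 + 1 / (\<alpha> * Gamma \<alpha>)) * rising_ratio \<alpha> p"
    using le assms rising_ratio_pos[of \<alpha> p] Gamma_real_pos[of \<alpha>]
    by (intro enn2real_leI) auto
qed

text \<open>Away from \<open>p = 0\<close> and from the truncated cell, both quantities lie between
  the densities at \<open>p + 1\<close> and at \<open>p\<close>, whose difference is small by
  \<open>power_density_diff\<close>. In the two exceptional cases the bracket is at least 1 and a
  crude bound suffices.\<close>

lemma rising_ratio_cell_mass_diff:
  assumes "n > 0" "0 < \<alpha>" "\<alpha> \<le> 1" "real p \<le> real n * v"
  shows "\<bar>rising_ratio \<alpha> p - enn2real (cell_mass \<alpha> n v p)\<bar>
       \<le> (3 + 1 / (\<alpha> * Gamma \<alpha>)) * (rising_ratio \<alpha> p * (1 / (real p + 1) + of_bool (p = nat \<lfloor>real n * v\<rfloor>)))"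
proof -
  let ?a = "rising_ratio \<alpha> p" and ?B = "enn2real (cell_mass \<alpha> n v p)" and ?K = "1 / (\<alpha> * Gamma \<alpha>)"
  have a: "?a > 0" using assms by (intro rising_ratio_pos) auto
  have K: "?K \<ge> 0" using assms Gamma_real_pos[of \<alpha>] by simp
  have B: "0 \<le> ?B" "?B \<le> (2 + ?K) * ?a" using cell_mass_real[OF assms(1-3)] by auto
  have "(3 + ?K) * ?a = (2 + ?K) * ?a + ?a" by (simp only: distrib_right)
  then have trivial_bound: "\<bar>?a - ?B\<bar> \<le> (3 + ?K) * ?a"
    using a B by linarith
  consider "p = 0" | "p \<ge> 1" "p = nat \<lfloor>real n * v\<rfloor>" | "p \<ge> 1" "p \<noteq> nat \<lfloor>real n * v\<rfloor>" by linarith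
  then show ?thesis
  proof cases
    case 1
    have "(3 + ?K) * ?a \<le> (3 + ?K) * (?a * (1 / (real p + 1) + of_bool (p = nat \<lfloor>real n * v\<rfloor>)))"
      using 1 K by (intro mult_left_mono) auto
    then show ?thesis using trivial_bound by linarith
  next
    case 2
    have "(3 + ?K) * (?a * 1) \<le> (3 + ?K) * (?a * (1 / (real p + 1) + of_bool (p = nat \<lfloor>real n * v\<rfloor>)))"
      using 2 K a by (intro mult_left_mono) auto
    then show ?thesis using trivial_bound by linarith
  next
    case 3
    \<comment> \<open>\<open>p\<close> is below the floor of \<open>n * v\<close>, so the whole cell
      lies below \<open>v\<close>.\<close>
    then have v: "real p + 1 \<le> real n * v" using assms(4) by linarith
    have "power_density \<alpha> (real p + 1) \<le> ?B"
      using power_density_le_cell_mass[OF assms(1-3) 3(1) v] cell_mass_real(1)[OF assms(1-3), of v p] B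
      by (metis ennreal_le_iff)
    moreover have "?B \<le> power_density \<alpha> (real p)"
      using cell_mass_le_power_density[OF assms(1-3) 3(1)] power_density_nonneg[OF assms(2)]
      by (intro enn2real_leI) auto
    moreover have "power_density \<alpha> (real p + 1) \<le> ?a"
      using assms by (intro power_density_le_rising_ratio) auto
    moreover have "?a \<le> power_density \<alpha> (real p)"
      using assms 3 by (intro rising_ratio_le_power_density) auto
    moreover have "power_density \<alpha> (real p) - power_density \<alpha> (real p + 1)
        \<le> 2 * (real p + 1 - real p) * (power_density \<alpha> (real p + 1) / (real p + 1))"
      using assms 3 by (intro power_density_diff) auto
    ultimately have "\<bar>?a - ?B\<bar> \<le> 2 * (power_density \<alpha> (real p + 1) / (real p + 1))" by (simp add: abs_le_iff)
    also have "\<dots> \<le> 2 * (?a / (real p + 1))"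
      using \<open>power_density \<alpha> (real p + 1) \<le> ?a\<close> by (intro mult_left_mono divide_right_mono) auto
    also have "\<dots> \<le> (3 + ?K) * (?a / (real p + 1))"
      using K a by (intro mult_right_mono) auto
    finally show ?thesis using 3 by simp
  qed
qed

text \<open>Telescoping: exchange the factors one at a time and bound all the others by
  \<open>c\<close>.\<close>

lemma abs_prod_diff_le:
  fixes a b c :: "'i \<Rightarrow> real"
  assumes "finite I" "\<And>i. i \<in> I \<Longrightarrow> \<bar>a i\<bar> \<le> c i" "\<And>i. i \<in> I \<Longrightarrow> \<bar>b i\<bar> \<le> c i"
  shows "\<bar>prod a I - prod b I\<bar> \<le> (\<Sum>i\<in>I. \<bar>a i - b i\<bar> * prod c (I - {i}))"
  using assms
proof (induction I)
  case empty
  then show ?case by simp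
next
  case (insert j I)
  have c: "c i \<ge> 0" if "i \<in> insert j I" for i
    using insert.prems(1)[OF that] by linarith
  have "prod a (insert j I) - prod b (insert j I)
      = (a j - b j) * prod a I + b j * (prod a I - prod b I)"
    using insert.hyps by (simp add: algebra_simps)
  then have "\<bar>prod a (insert j I) - prod b (insert j I)\<bar>
      \<le> \<bar>a j - b j\<bar> * \<bar>prod a I\<bar> + \<bar>b j\<bar> * \<bar>prod a I - prod b I\<bar>"
    by (metis abs_mult abs_triangle_ineq)
  also have "\<dots> \<le> \<bar>a j - b j\<bar> * prod c I + c j * (\<Sum>i\<in>I. \<bar>a i - b i\<bar> * prod c (I - {i}))"
  proof (intro add_mono mult_mono)
    show "\<bar>prod a I\<bar> \<le> prod c I"
      unfolding abs_prod using insert.prems by (intro prod_mono) auto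
    show "\<bar>prod a I - prod b I\<bar> \<le> (\<Sum>i\<in>I. \<bar>a i - b i\<bar> * prod c (I - {i}))"
      using insert by auto
  qed (use insert.prems c in auto)
  also have "c j * (\<Sum>i\<in>I. \<bar>a i - b i\<bar> * prod c (I - {i}))
      = (\<Sum>i\<in>I. \<bar>a i - b i\<bar> * prod c (insert j I - {i}))"
    unfolding sum_distrib_left
  proof (rule sum.cong)
    fix i assume i: "i \<in> I"
    then have "insert j I - {i} = insert j (I - {i})" using insert.hyps by auto
    then show "c j * (\<bar>a i - b i\<bar> * prod c (I - {i})) = \<bar>a i - b i\<bar> * prod c (insert j I - {i})"
      using insert.hyps by simp
  qed simp
  also have "\<bar>a j - b j\<bar> * prod c I + \<dots> = (\<Sum>i\<in>insert j I. \<bar>a i - b i\<bar> * prod c (insert j I - {i}))"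
    using insert.hyps by simp
  finally show ?case .
qed

subsection \<open>Integrals over cells\<close>

text \<open>The last factor stands for the dependent coordinate
  \<open>1 - (\<Sum>i\<in>I. t i)\<close>; it carries no Jacobian \<open>n\<close>, since only the
  coordinates in \<open>I\<close> are integrated.\<close>

definition cell_integral ::
    "'i set \<Rightarrow> real \<Rightarrow> nat \<Rightarrow> ('i \<Rightarrow> real) \<Rightarrow> ('i \<Rightarrow> nat) \<Rightarrow> ennreal" where
  "cell_integral I \<alpha> n u m =
     (\<integral>\<^sup>+ t. (\<Prod>i\<in>I. cell_density \<alpha> n (u i) (m i) (t i)) *
        ennreal (power_density \<alpha> (real n * (1 - (\<Sum>i\<in>I. t i)))) \<partial>(\<Pi>\<^sub>M i\<in>I. lborel))"

lemma prod_cell_density_nonzero: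
  assumes "finite I" "(\<Prod>i\<in>I. cell_density \<alpha> n (u i) (m i) (t i)) \<noteq> 0" "i \<in> I"
  shows "t i \<in> cell n (u i) (m i)"
proof (rule ccontr)
  assume "t i \<notin> cell n (u i) (m i)"
  then have "cell_density \<alpha> n (u i) (m i) (t i) = 0" by (simp add: cell_density_def)
  then have "(\<Prod>i\<in>I. cell_density \<alpha> n (u i) (m i) (t i)) = 0"
    using assms by (intro prod_zero) auto
  then show False using assms by simp
qed

lemma nn_integral_prod_cell_density:
  assumes "finite I"
  shows "(\<integral>\<^sup>+ t. (\<Prod>i\<in>I. cell_density \<alpha> n (u i) (m i) (t i)) \<partial>(\<Pi>\<^sub>M i\<in>I. lborel))
       = (\<Prod>i\<in>I. cell_mass \<alpha> n (u i) (m i))"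
proof -
  interpret product_sigma_finite "\<lambda>_::'a. lborel::real measure" by standard
  show ?thesis unfolding cell_mass_def
    using assms by (intro product_nn_integral_prod) auto
qed

lemma cell_sum_bounds:
  assumes "finite I" "\<And>i. i \<in> I \<Longrightarrow> t i \<in> cell n (u i) (m i)"
  shows "real (sum m I) \<le> real n * (\<Sum>i\<in>I. t i)"
    and "real n * (\<Sum>i\<in>I. t i) \<le> real (sum m I) + real (card I)"
proof -
  have "(\<Sum>i\<in>I. real (m i)) \<le> (\<Sum>i\<in>I. real n * t i)"
    using assms by (intro sum_mono) (auto simp: cell_def)
  then show "real (sum m I) \<le> real n * (\<Sum>i\<in>I. t i)" by (simp add: sum_distrib_left)
  have "(\<Sum>i\<in>I. real n * t i) \<le> (\<Sum>i\<in>I. real (m i) + 1)"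
    using assms by (intro sum_mono) (force simp: cell_def)
  then show "real n * (\<Sum>i\<in>I. t i) \<le> real (sum m I) + real (card I)"
    by (simp add: sum_distrib_left sum.distrib)
qed

text \<open>On the cell, the argument \<open>n * (1 - (\<Sum>i\<in>I. t i))\<close> lies between
  \<open>M - card I\<close> and \<open>M\<close>; as \<open>M > card I\<close>, this range is
  positive and the density is monotone on it.\<close>

lemma cell_integral_far:
  assumes "finite I" "0 < \<alpha>" "\<alpha> \<le> 1" and M: "n = sum m I + M" "M > card I"
  shows "ennreal (power_density \<alpha> (real M)) * (\<Prod>i\<in>I. cell_mass \<alpha> n (u i) (m i)) \<le> cell_integral I \<alpha> n u m"
    and "cell_integral I \<alpha> n u m
      \<le> ennreal (power_density \<alpha> (real M - real (card I))) * (\<Prod>i\<in>I. cell_mass \<alpha> n (u i) (m i))"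
proof -
  let ?P = "\<lambda>t. \<Prod>i\<in>I. cell_density \<alpha> n (u i) (m i) (t i)"
  let ?q = "\<lambda>t. power_density \<alpha> (real n * (1 - (\<Sum>i\<in>I. t i)))"
  have bd: "power_density \<alpha> (real M) \<le> ?q t \<and> ?q t \<le> power_density \<alpha> (real M - real (card I))"
    if "?P t \<noteq> 0" for t
  proof -
    note t = prod_cell_density_nonzero[OF assms(1) that]
    have "real n = real (sum m I) + real M" using M by simp
    then have "real M - real (card I) \<le> real n * (1 - (\<Sum>i\<in>I. t i))" "real n * (1 - (\<Sum>i\<in>I. t i)) \<le> real M"
      using cell_sum_bounds[where t = t and u = u and m = m and n = n and I = I, OF assms(1) t]
      unfolding right_diff_distrib mult_1_right by linarith+
    then show ?thesis using M assms(2,3) by (auto intro!: power_density_antimono)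
  qed
  have const: "(\<integral>\<^sup>+ t. ?P t * ennreal c \<partial>(\<Pi>\<^sub>M i\<in>I. lborel))
      = ennreal c * (\<Prod>i\<in>I. cell_mass \<alpha> n (u i) (m i))" for c
    using assms(1)
    by (subst nn_integral_multc) (auto simp: nn_integral_prod_cell_density mult.commute)
  show "ennreal (power_density \<alpha> (real M)) * (\<Prod>i\<in>I. cell_mass \<alpha> n (u i) (m i)) \<le> cell_integral I \<alpha> n u m"
    unfolding const[symmetric] cell_integral_def
  proof (rule nn_integral_mono)
    fix t show "?P t * ennreal (power_density \<alpha> (real M)) \<le> ?P t * ennreal (?q t)"
    proof (cases "?P t = 0")
      case True
      then show ?thesis by (simp only: mult_zero_left order_refl)
    next
      case False
      then show ?thesis using bd by (intro mult_left_mono ennreal_leI) auto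
    qed
  qed
  show "cell_integral I \<alpha> n u m
      \<le> ennreal (power_density \<alpha> (real M - real (card I))) * (\<Prod>i\<in>I. cell_mass \<alpha> n (u i) (m i))"
    unfolding const[symmetric] cell_integral_def
  proof (rule nn_integral_mono)
    fix t show "?P t * ennreal (?q t) \<le> ?P t * ennreal (power_density \<alpha> (real M - real (card I)))"
    proof (cases "?P t = 0")
      case True
      then show ?thesis by (simp only: mult_zero_left order_refl)
    next
      case False
      then show ?thesis using bd by (intro mult_left_mono ennreal_leI) auto
    qed
  qed
qed

text \<open>Where the reflected argument is at most 1, the substitution \<open>s = r - n * y\<close>
  leaves at most the mass over \<open>[0, 1]\<close>. Elsewhere the density is at most
  \<open>power_density \<alpha> 1\<close>, and the cell has length at most
  \<open>1 / n\<close>.\<close>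

lemma nn_integral_reflected_power_density:
  assumes "n > 0" "0 < \<alpha>" "\<alpha> \<le> 1"
  shows "(\<integral>\<^sup>+ y. indicator (cell n v p) y *
           (ennreal (real n) * (indicator {0..} (r - real n * y) * ennreal (power_density \<alpha> (r - real n * y)))) \<partial>lborel)
       \<le> ennreal (1 / (\<alpha> * Gamma \<alpha>) + power_density \<alpha> 1)"
proof -
  let ?d = "power_density \<alpha>"
  let ?f = "\<lambda>s. indicator {0..1} s * ennreal (?d s) :: ennreal"
  have pt: "indicator {0..} s * ennreal (?d s) \<le> ?f s + ennreal (?d 1)" for s
  proof (cases "s \<le> 1")
    case True
    then show ?thesis by (auto simp: indicator_def)
  next
    case False
    then have "?d s \<le> ?d 1" using assms by (intro power_density_antimono) auto
    then show ?thesis using False by (auto simp: indicator_def intro: ennreal_leI)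
  qed
  have "(\<integral>\<^sup>+ y. indicator (cell n v p) y *
           (ennreal (real n) * (indicator {0..} (r - real n * y) * ennreal (?d (r - real n * y)))) \<partial>lborel)
      \<le> (\<integral>\<^sup>+ y. ennreal (real n) * ?f (r - real n * y) + ennreal (real n * ?d 1) * indicator (cell n v p) y \<partial>lborel)"
  proof (rule nn_integral_mono)
    fix y
    have "ennreal (real n) * (indicator {0..} (r - real n * y) * ennreal (?d (r - real n * y)))
        \<le> ennreal (real n) * (?f (r - real n * y) + ennreal (?d 1))"
      by (intro mult_left_mono pt) auto
    also have "\<dots> = ennreal (real n) * ?f (r - real n * y) + ennreal (real n * ?d 1)"
      using assms by (simp add: distrib_left ennreal_mult' power_density_nonneg)
    finally show "indicator (cell n v p) y *
           (ennreal (real n) * (indicator {0..} (r - real n * y) * ennreal (?d (r - real n * y))))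
         \<le> ennreal (real n) * ?f (r - real n * y) + ennreal (real n * ?d 1) * indicator (cell n v p) y"
      by (cases "y \<in> cell n v p") auto
  qed
  also have "\<dots> = (\<integral>\<^sup>+ y. ennreal (real n) * ?f (r - real n * y) \<partial>lborel)
      + (\<integral>\<^sup>+ y. ennreal (real n * ?d 1) * indicator (cell n v p) y \<partial>lborel)"
    by (intro nn_integral_add) auto
  also have "(\<integral>\<^sup>+ y. ennreal (real n) * ?f (r - real n * y) \<partial>lborel)
      = ennreal (real n) * (\<integral>\<^sup>+ y. ?f (r - real n * y) \<partial>lborel)"
    by (rule nn_integral_cmult) measurable
  also have "\<dots> = (\<integral>\<^sup>+ s. ?f s \<partial>lborel)"
    using nn_integral_real_affine[of ?f "- real n" r] assms by simp
  also have "\<dots> = ennreal (1 / (\<alpha> * Gamma \<alpha>))"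
    by (rule nn_integral_power_density_unit[OF assms(2)])
  also have "(\<integral>\<^sup>+ y. ennreal (real n * ?d 1) * indicator (cell n v p) y \<partial>lborel) \<le> ennreal (?d 1)"
  proof -
    have "(\<integral>\<^sup>+ y. ennreal (real n * ?d 1) * indicator (cell n v p) y \<partial>lborel)
        = ennreal (real n * ?d 1) * emeasure lborel (cell n v p)"
      by (rule nn_integral_cmult_indicator) simp
    also have "emeasure lborel (cell n v p) \<le> emeasure lborel {real p / real n .. (real p + 1) / real n}"
      using assms by (intro emeasure_mono) (auto simp: cell_def field_simps)
    also have "\<dots> = ennreal (1 / real n)"
      using assms by (simp add: divide_right_mono diff_divide_distrib[symmetric])
    finally have "(\<integral>\<^sup>+ y. ennreal (real n * ?d 1) * indicator (cell n v p) y \<partial>lborel)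
        \<le> ennreal (real n * ?d 1) * ennreal (1 / real n)"
      by (simp add: mult_left_mono)
    also have "\<dots> = ennreal (?d 1)"
      using assms by (simp add: ennreal_mult''[symmetric])
    finally show ?thesis .
  qed
  finally show ?thesis
    using assms Gamma_real_pos[of \<alpha>] by (simp add: ennreal_plus power_density_nonneg add_left_mono)
qed

text \<open>Close to the face \<open>\<Sum>i. t i = 1\<close> the last factor is singular. Some \<open>t j\<close> is then bounded away
  from \<open>0\<close>, and integrating over \<open>t j\<close> first removes the singularity.\<close>

lemma cell_integral_near:
  fixes u :: "'i \<Rightarrow> real"
  assumes I: "finite I" and n: "n > 0" and \<alpha>: "0 < \<alpha>" "\<alpha> \<le> 1"
    and j: "j \<in> I" "m j \<ge> 1" and u: "(\<Sum>i\<in>I. u i) \<le> 1"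
  shows "cell_integral I \<alpha> n u m \<le>
     ennreal (power_density \<alpha> (real (m j)) * (1 / (\<alpha> * Gamma \<alpha>) + power_density \<alpha> 1)) *
     (\<Prod>i\<in>I - {j}. cell_mass \<alpha> n (u i) (m i))"
proof -
  interpret product_sigma_finite "\<lambda>_::'i. lborel::real measure" by standard
  define J where "J = I - {j}"
  have J: "finite J" "j \<notin> J" "I = insert j J" using I j by (auto simp: J_def)
  let ?d = "power_density \<alpha>"
  let ?P = "\<lambda>K t. \<Prod>i\<in>K. cell_density \<alpha> n (u i) (m i) (t i)"
  let ?f = "\<lambda>t. ?P I t * ennreal (?d (real n * (1 - (\<Sum>i\<in>I. t i))))"
  let ?h = "\<lambda>x y. indicator (cell n (u j) (m j)) y * (ennreal (real n) *
      (indicator {0..} (real n * (1 - sum x J) - real n * y) *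
        ennreal (?d (real n * (1 - sum x J) - real n * y)))) :: ennreal"
  have meas: "?f \<in> borel_measurable (\<Pi>\<^sub>M i\<in>insert j J. lborel)"
    using J by simp
  have pt: "?f (x(j := y)) \<le> ?P J x * ennreal (?d (real (m j))) * ?h x y" for x y
  proof (cases "?P I (x(j := y)) = 0")
    case False
    have t: "(x(j := y)) i \<in> cell n (u i) (m i)" if "i \<in> I" for i
      by (rule prod_cell_density_nonzero[OF I False that])
    \<comment> \<open>The hypothesis on \<open>u\<close> keeps the last argument nonnegative on the
      cell, so that the indicator in \<open>?h\<close> may be inserted.\<close>
    have "(\<Sum>i\<in>I. (x(j := y)) i) \<le> (\<Sum>i\<in>I. u i)"
      using t by (intro sum_mono) (auto simp: cell_def)
    then have le1: "(\<Sum>i\<in>I. (x(j := y)) i) \<le> 1" using u by linarith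
    have sumI: "(\<Sum>i\<in>I. (x(j := y)) i) = y + sum x J"
      unfolding J(3) using J(1,2) by (simp add: sum.cong[of J J x "\<lambda>i. if i = j then y else x i"])
        (intro sum.cong; auto)
    have PI: "?P I (x(j := y)) = cell_density \<alpha> n (u j) (m j) y * ?P J x"
      unfolding J(3) using J(1,2) by (simp, intro disjI2 arg_cong2[of _ _ _ _ "(*)"] refl prod.cong) auto
    have y: "y \<in> cell n (u j) (m j)" using t[OF j(1)] by simp
    \<comment> \<open>\<open>m j \<ge> 1\<close> keeps \<open>real n * y\<close> away from the
      singularity of the factor at \<open>j\<close>, which is replaced by a constant.\<close>
    have "?d (real n * y) \<le> ?d (real (m j))"
      using y j \<alpha> by (intro power_density_antimono) (auto simp: cell_def)
    then have "cell_density \<alpha> n (u j) (m j) y \<le> ennreal (real n) * ennreal (?d (real (m j)))"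
      using y by (simp add: cell_density_def ennreal_mult'[symmetric] ennreal_leI mult_left_mono)
    then have "?f (x(j := y)) \<le> (ennreal (real n) * ennreal (?d (real (m j)))) * ?P J x *
        ennreal (?d (real n * (1 - (y + sum x J))))"
      unfolding PI sumI by (intro mult_right_mono) auto
    also have "\<dots> = ?P J x * ennreal (?d (real (m j))) *
        (ennreal (real n) * ennreal (?d (real n * (1 - (y + sum x J)))))"
      by (simp add: mult_ac)
    also have "real n * (1 - (y + sum x J)) = real n * (1 - sum x J) - real n * y"
      by (simp add: algebra_simps)
    also have "?P J x * ennreal (?d (real (m j))) *
        (ennreal (real n) * ennreal (?d (real n * (1 - sum x J) - real n * y)))
        = ?P J x * ennreal (?d (real (m j))) * ?h x y"
    proof -
      have "real n * (1 - (y + sum x J)) \<ge> 0" using le1 sumI by simp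
      then have "real n * (1 - sum x J) - real n * y \<ge> 0" by (simp add: algebra_simps)
      then show ?thesis using y by simp
    qed
    finally show ?thesis .
  next
    case True
    then show ?thesis by (simp only: mult_zero_left zero_le)
  qed
  \<comment> \<open>Fubini with \<open>t j\<close> as the innermost variable.\<close>
  have "cell_integral I \<alpha> n u m = (\<integral>\<^sup>+ x. (\<integral>\<^sup>+ y. ?f (x(j := y)) \<partial>lborel) \<partial>(\<Pi>\<^sub>M i\<in>J. lborel))"
    unfolding cell_integral_def using product_nn_integral_insert[OF J(1,2) meas] J(3) by simp
  also have "\<dots> \<le> (\<integral>\<^sup>+ x. (\<integral>\<^sup>+ y. ?P J x * ennreal (?d (real (m j))) * ?h x y \<partial>lborel) \<partial>(\<Pi>\<^sub>M i\<in>J. lborel))"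
    by (intro nn_integral_mono pt)
  also have "\<dots> = (\<integral>\<^sup>+ x. ?P J x * ennreal (?d (real (m j))) * (\<integral>\<^sup>+ y. ?h x y \<partial>lborel) \<partial>(\<Pi>\<^sub>M i\<in>J. lborel))"
    by (intro nn_integral_cong nn_integral_cmult) measurable
  also have "\<dots> \<le> (\<integral>\<^sup>+ x. ?P J x * ennreal (?d (real (m j))) *
      ennreal (1 / (\<alpha> * Gamma \<alpha>) + ?d 1) \<partial>(\<Pi>\<^sub>M i\<in>J. lborel))"
    by (intro nn_integral_mono mult_left_mono nn_integral_reflected_power_density n \<alpha>) auto
  also have "\<dots> = (\<integral>\<^sup>+ x. ?P J x * ennreal (?d (real (m j)) * (1 / (\<alpha> * Gamma \<alpha>) + ?d 1)) \<partial>(\<Pi>\<^sub>M i\<in>J. lborel))"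
  proof -
    have "ennreal (?d (real (m j))) * ennreal (1 / (\<alpha> * Gamma \<alpha>) + ?d 1)
        = ennreal (?d (real (m j)) * (1 / (\<alpha> * Gamma \<alpha>) + ?d 1))"
      using \<alpha> Gamma_real_pos[of \<alpha>]
      by (intro ennreal_mult[symmetric] add_nonneg_nonneg power_density_nonneg) auto
    then show ?thesis by (simp only: mult.assoc)
  qed
  also have "\<dots> = ennreal (?d (real (m j)) * (1 / (\<alpha> * Gamma \<alpha>) + ?d 1)) * (\<Prod>i\<in>J. cell_mass \<alpha> n (u i) (m i))"
    using J by (subst nn_integral_multc) (auto simp: nn_integral_prod_cell_density mult.commute)
  finally show ?thesis by (simp add: J_def)
qed

text \<open>For \<open>M > card I\<close> the ratio at \<open>M\<close> and the last density both
  lie between the densities at \<open>M + 1\<close> and \<open>M - card I\<close>, which differ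
  little. For the finitely many \<open>M \<le> card I\<close> the factor
  \<open>rising_ratio \<alpha> M / (M + 1)\<close> is bounded below, so crude bounds on both terms
  suffice.\<close>

lemma cell_integral_estimate:
  assumes I: "finite I" and \<alpha>: "0 < \<alpha>" "\<alpha> \<le> 1"
  obtains C where "C \<ge> 0" and "\<And>n u m M. \<lbrakk>n = sum m I + M; n > card I; (\<Sum>i\<in>I. u i) \<le> 1\<rbrakk> \<Longrightarrow>
      cell_integral I \<alpha> n u m < \<infinity> \<and>
      \<bar>(\<Prod>i\<in>I. enn2real (cell_mass \<alpha> n (u i) (m i))) * rising_ratio \<alpha> M - enn2real (cell_integral I \<alpha> n u m)\<bar>
        \<le> C * ((\<Prod>i\<in>I. rising_ratio \<alpha> (m i)) * (rising_ratio \<alpha> M / (real M + 1)))"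
proof -
  let ?a = "rising_ratio \<alpha>" and ?\<psi> = "power_density \<alpha>"
  define d where "d = card I"
  define K0 where "K0 = 1 / (\<alpha> * Gamma \<alpha>)"
  define K where "K = 2 + K0"
  have G: "Gamma \<alpha> > 0" using \<alpha> by (simp add: Gamma_real_pos)
  have K0: "K0 \<ge> 0" unfolding K0_def using G \<alpha> by simp
  have K: "K \<ge> 2" unfolding K_def using K0 by simp
  have apos: "?a p > 0" for p using \<alpha> by (intro rising_ratio_pos) auto
  have \<psi>0: "?\<psi> x \<ge> 0" for x using \<alpha> by (intro power_density_nonneg) auto
  have \<psi>pos: "?\<psi> x > 0" if "x > 0" for x using that G by (simp add: power_density_def)
  \<comment> \<open>For small \<open>M\<close>: \<open>1 + 2 / Gamma \<alpha>\<close> bounds the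
    ratio at \<open>M\<close>, and the rest comes from the bound on the cell integral.\<close>
  define L where "L = 1 + 2 / Gamma \<alpha> + K0 + ?\<psi> 1"
  have L: "L \<ge> 0" unfolding L_def using G K0 \<psi>0[of 1] by simp
  \<comment> \<open>\<open>d + 2\<close> is the comparability constant and \<open>d + 1\<close> the
    gap between \<open>M - d\<close> and \<open>M + 1\<close>; \<open>K ^ d\<close> passes from cell
    masses to ratios.\<close>
  define C1 where "C1 = K ^ d * ((real d + 2) * (real d + 1))"
  \<comment> \<open>The inner quotient inverts a lower bound for
    \<open>rising_ratio \<alpha> M / (M + 1)\<close> that is valid for all
    \<open>M \<le> d\<close>.\<close>
  define C2 where "C2 = K ^ d * (L * ((real d + 1) / ?\<psi> (real d + 1)))"
  have C: "C1 \<ge> 0" "C2 \<ge> 0" unfolding C1_def C2_def using K L \<psi>0 by auto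
  have B0: "enn2real (cell_mass \<alpha> n v p) \<ge> 0" for n v p by simp
  have B1: "enn2real (cell_mass \<alpha> n v p) \<le> K * ?a p" if "n > 0" for n v p
    unfolding K_def K0_def using cell_mass_real(2)[OF that \<alpha>] .
  have prodB: "(\<Prod>i\<in>J. cell_mass \<alpha> n (u i) (m i)) = ennreal (\<Prod>i\<in>J. enn2real (cell_mass \<alpha> n (u i) (m i)))"
    if "n > 0" for n u m and J :: "'a set"
    by (subst prod_ennreal[symmetric]) (auto simp: cell_mass_real(1)[OF that \<alpha>, symmetric])
  have PB: "(\<Prod>i\<in>J. enn2real (cell_mass \<alpha> n (u i) (m i))) \<le> (\<Prod>i\<in>J. K * ?a (m i))"
    if "n > 0" for n u m and J :: "'a set"
    using that by (intro prod_mono conjI B0 B1)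
  have PK: "(\<Prod>i\<in>I. K * ?a (m i)) = K ^ d * (\<Prod>i\<in>I. ?a (m i))" for m
    by (simp add: prod.distrib d_def)
  show thesis
  proof (rule that[of "C1 + C2"])
    show "C1 + C2 \<ge> 0" using C by simp
  next
    fix n u m M
    assume n: "n = sum m I + M" and nd: "n > card I" and u: "(\<Sum>i\<in>I. u i) \<le> (1::real)"
    have n0: "n > 0" using nd by simp
    define P where "P = (\<Prod>i\<in>I. enn2real (cell_mass \<alpha> n (u i) (m i)))"
    define A where "A = (\<Prod>i\<in>I. ?a (m i))"
    define J where "J = cell_integral I \<alpha> n u m"
    have A: "A \<ge> 0" unfolding A_def by (intro prod_nonneg) (auto intro: less_imp_le apos)
    have P0: "P \<ge> 0" unfolding P_def by (intro prod_nonneg) auto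
    have P1: "P \<le> K ^ d * A" using PB[OF n0] unfolding P_def A_def PK[symmetric] by simp
    have "J < \<infinity> \<and> \<bar>P * ?a M - enn2real J\<bar> \<le> (C1 + C2) * (A * (?a M / (real M + 1)))"
    proof (cases "M > card I")
      case M: True
      have Mr: "real M - real d \<ge> 1" using M by (simp add: d_def)
      have lo: "ennreal (?\<psi> M * P) \<le> J"
        using cell_integral_far(1)[OF I \<alpha> n M, of u] \<psi>0 P0 unfolding J_def prodB[OF n0] P_def[symmetric]
        by (simp add: ennreal_mult)
      have hi: "J \<le> ennreal (?\<psi> (real M - real d) * P)"
        using cell_integral_far(2)[OF I \<alpha> n M, of u] \<psi>0 P0 unfolding J_def prodB[OF n0] P_def[symmetric]
        by (simp add: ennreal_mult d_def)
      have fin: "J < \<infinity>" using hi ennreal_less_top order.strict_trans1 by (metis infinity_ennreal_def)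
      have hi': "enn2real J \<le> ?\<psi> (real M - real d) * P" using hi \<psi>0 P0 by (intro enn2real_leI) auto
      have lo': "?\<psi> M * P \<le> enn2real J"
        using lo fin by (metis enn2real_ennreal enn2real_mono infinity_ennreal_def \<psi>0 P0 mult_nonneg_nonneg)
      have aM: "?\<psi> (real M + 1) \<le> ?a M" "?a M \<le> ?\<psi> M"
        using \<alpha> M by (auto intro!: power_density_le_rising_ratio rising_ratio_le_power_density)
      have \<psi>M: "?\<psi> (real M + 1) \<le> ?\<psi> M" "?\<psi> M \<le> ?\<psi> (real M - real d)"
        using \<alpha> Mr by (auto intro!: power_density_antimono)
      have "\<bar>P * ?a M - enn2real J\<bar> \<le> P * (?\<psi> (real M - real d) - ?\<psi> (real M + 1))"
      proof -
        have "P * ?\<psi> (real M + 1) \<le> P * ?a M" "P * ?a M \<le> P * ?\<psi> (real M - real d)"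
          "P * ?\<psi> (real M + 1) \<le> P * ?\<psi> M"
          using aM \<psi>M P0 by (auto intro!: mult_left_mono)
        then show ?thesis using lo' hi' by (simp add: algebra_simps abs_le_iff)
      qed
      also have "\<dots> \<le> P * ((real d + 2) * (real M + 1 - (real M - real d)) * (?\<psi> (real M + 1) / (real M + 1)))"
      proof (intro mult_left_mono P0 power_density_diff \<alpha>)
        \<comment> \<open>Write \<open>M + 1\<close> as \<open>(M - d) + (d + 1)\<close> and use
          \<open>M - d \<ge> 1\<close>.\<close>
        have "(real d + 1) * 1 \<le> (real d + 1) * (real M - real d)" using Mr by (intro mult_left_mono) auto
        then show "real M + 1 \<le> (real d + 2) * (real M - real d)" by (simp add: algebra_simps)
      qed (use Mr in auto)
      also have "\<dots> \<le> (K ^ d * A) * ((real d + 2) * (real d + 1) * (?a M / (real M + 1)))"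
        using aM P0 P1 \<psi>0 K A by (intro mult_mono divide_right_mono) (auto intro!: divide_nonneg_nonneg)
      also have "\<dots> = C1 * (A * (?a M / (real M + 1)))" by (simp add: C1_def mult_ac)
      also have "\<dots> \<le> (C1 + C2) * (A * (?a M / (real M + 1)))"
        using C A apos[of M] by (intro mult_right_mono) auto
      finally show ?thesis using fin by blast
    next
      case False
      then have M: "M \<le> card I" by simp
      \<comment> \<open>\<open>M \<le> card I < n\<close> leaves a positive sum, so some
        \<open>m j\<close> is positive and \<open>cell_integral_near\<close> applies.\<close>
      have "sum m I \<noteq> 0" using n M nd by auto
      then obtain j where j: "j \<in> I" "m j \<ge> 1"
        using sum.neutral[of I m] by (metis One_nat_def Suc_leI neq0_conv)
      have "J \<le> ennreal (?\<psi> (real (m j)) * (K0 + ?\<psi> 1)) * (\<Prod>i\<in>I - {j}. cell_mass \<alpha> n (u i) (m i))"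
        unfolding J_def K0_def by (rule cell_integral_near[where m = m and j = j, OF I n0 \<alpha> j u])
      also have "\<dots> = ennreal (?\<psi> (real (m j)) * (K0 + ?\<psi> 1) *
          (\<Prod>i\<in>I - {j}. enn2real (cell_mass \<alpha> n (u i) (m i))))"
        unfolding prodB[OF n0] using \<psi>0 K0
        by (intro ennreal_mult[symmetric]) (auto intro!: prod_nonneg)
      also have "\<dots> \<le> ennreal ((K0 + ?\<psi> 1) * (K ^ d * A))"
      proof (rule ennreal_leI)
        \<comment> \<open>The density at \<open>m j\<close> fills the place of the factor missing at
          \<open>j\<close>.\<close>
        have "?\<psi> (real (m j)) \<le> 2 * ?\<psi> (real (m j) + 1)"
          using j \<alpha> by (intro power_density_le_mult) auto
        also have "\<dots> \<le> 2 * ?a (m j)"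
          using \<alpha> by (intro mult_left_mono power_density_le_rising_ratio) auto
        also have "\<dots> \<le> K * ?a (m j)"
          using K apos[of "m j"] by (intro mult_right_mono) auto
        finally have "?\<psi> (real (m j)) * (K0 + ?\<psi> 1) * (\<Prod>i\<in>I - {j}. enn2real (cell_mass \<alpha> n (u i) (m i)))
            \<le> (K * ?a (m j)) * (K0 + ?\<psi> 1) * (\<Prod>i\<in>I - {j}. K * ?a (m i))"
          using K0 \<psi>0[of 1] K apos[of "m j"]
          by (intro mult_mono PB[OF n0]) (auto intro!: prod_nonneg)
        also have "\<dots> = (K0 + ?\<psi> 1) * (\<Prod>i\<in>I. K * ?a (m i))"
          unfolding prod.remove[OF I j(1)] by (simp add: mult_ac)
        finally show "?\<psi> (real (m j)) * (K0 + ?\<psi> 1) * (\<Prod>i\<in>I - {j}. enn2real (cell_mass \<alpha> n (u i) (m i)))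
            \<le> (K0 + ?\<psi> 1) * (K ^ d * A)"
          unfolding A_def PK .
      qed
      finally have hi: "J \<le> ennreal ((K0 + ?\<psi> 1) * (K ^ d * A))" .
      have fin: "J < \<infinity>" using hi ennreal_less_top order.strict_trans1 by (metis infinity_ennreal_def)
      have hi': "enn2real J \<le> (K0 + ?\<psi> 1) * (K ^ d * A)"
        using hi K0 \<psi>0[of 1] K A by (intro enn2real_leI) auto
      have "?a M \<le> (1 + 2 / Gamma \<alpha>) * (real M + 1) powr (\<alpha> - 1)"
        using \<alpha> by (intro rising_ratio_le_powr) auto
      also have "\<dots> \<le> (1 + 2 / Gamma \<alpha>) * (real M + 1) powr 0"
        using \<alpha> G by (intro mult_left_mono powr_mono) auto
      finally have aM: "?a M \<le> 1 + 2 / Gamma \<alpha>" by simp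
      have "P * ?a M \<le> (K ^ d * A) * (1 + 2 / Gamma \<alpha>)"
        using P1 aM K A apos[of M] P0 by (intro mult_mono) auto
      moreover have "P * ?a M \<ge> 0" using P0 apos[of M] by simp
      moreover have "enn2real J \<ge> 0" by simp
      ultimately have "\<bar>P * ?a M - enn2real J\<bar> \<le> (K ^ d * A) * (1 + 2 / Gamma \<alpha>) + (K0 + ?\<psi> 1) * (K ^ d * A)"
        using hi' by linarith
      also have "\<dots> = K ^ d * A * L * 1" by (simp add: L_def algebra_simps)
      also have "\<dots> \<le> K ^ d * A * L * (((real d + 1) / ?\<psi> (real d + 1)) * (?a M / (real M + 1)))"
      proof (intro mult_left_mono)
        have "1 = (real d + 1) / ?\<psi> (real d + 1) * (?\<psi> (real d + 1) / (real d + 1))"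
          using \<psi>pos[of "real d + 1"] by simp
        also have "\<dots> \<le> (real d + 1) / ?\<psi> (real d + 1) * (?a M / (real M + 1))"
        proof (rule mult_left_mono)
          have "?\<psi> (real d + 1) / (real d + 1) \<le> ?\<psi> (real M + 1) / (real M + 1)"
            using M \<alpha> \<psi>0 by (intro frac_le power_density_antimono) (auto simp: d_def)
          also have "\<dots> \<le> ?a M / (real M + 1)"
            using \<alpha> by (intro divide_right_mono power_density_le_rising_ratio) auto
          finally show "?\<psi> (real d + 1) / (real d + 1) \<le> ?a M / (real M + 1)" .
        qed (use \<psi>0 in simp)
        finally show "1 \<le> (real d + 1) / ?\<psi> (real d + 1) * (?a M / (real M + 1))" .
      qed (use K A L in auto)
      also have "\<dots> = C2 * (A * (?a M / (real M + 1)))" by (simp add: C2_def mult_ac)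
      also have "\<dots> \<le> (C1 + C2) * (A * (?a M / (real M + 1)))"
        using C A apos[of M] by (intro mult_right_mono) auto
      finally show ?thesis using fin by blast
    qed
    then show "cell_integral I \<alpha> n u m < \<infinity> \<and>
        \<bar>(\<Prod>i\<in>I. enn2real (cell_mass \<alpha> n (u i) (m i))) * ?a M - enn2real (cell_integral I \<alpha> n u m)\<bar>
        \<le> (C1 + C2) * ((\<Prod>i\<in>I. ?a (m i)) * (?a M / (real M + 1)))"
      unfolding P_def A_def J_def .
  qed
qed

section \<open>Error terms and their sums over compositions\<close>

text \<open>Up to a constant, the relative error of one coordinate: discretisation, plus truncation
  of the cell by the face at \<open>v\<close>.\<close>

definition cell_error :: "nat \<Rightarrow> real \<Rightarrow> nat \<Rightarrow> real" where
  "cell_error n v p = 1 / (real p + 1) + of_bool (p = nat \<lfloor>real n * v\<rfloor>)"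

lemma cell_error_nonneg: "cell_error n v p \<ge> 0"
  by (simp add: cell_error_def)

text \<open>Ratios are exchanged for cell masses one coordinate at a time, and
  \<open>cell_integral_estimate\<close> then passes to the integral. No face cuts the dependent
  coordinate, so it contributes only \<open>1 / (M + 1)\<close>.\<close>

lemma rising_ratio_cell_integral_diff:
  assumes I: "finite I" and \<alpha>: "0 < \<alpha>" "\<alpha> \<le> 1"
  obtains C where "C \<ge> 0" and "\<And>n u m M.
      \<lbrakk>n = sum m I + M; n > card I; (\<Sum>i\<in>I. u i) \<le> 1; \<And>i. i \<in> I \<Longrightarrow> real (m i) \<le> real n * u i\<rbrakk> \<Longrightarrow>
      cell_integral I \<alpha> n u m < \<infinity> \<and>
      \<bar>(\<Prod>i\<in>I. rising_ratio \<alpha> (m i)) * rising_ratio \<alpha> M - enn2real (cell_integral I \<alpha> n u m)\<bar>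
        \<le> C * ((\<Prod>i\<in>I. rising_ratio \<alpha> (m i)) * rising_ratio \<alpha> M *
                ((\<Sum>i\<in>I. cell_error n (u i) (m i)) + 1 / (real M + 1)))"
proof -
  let ?a = "rising_ratio \<alpha>"
  obtain C where C: "C \<ge> 0" and est: "\<And>n u m M. \<lbrakk>n = sum m I + M; n > card I; (\<Sum>i\<in>I. u i) \<le> 1\<rbrakk> \<Longrightarrow>
      cell_integral I \<alpha> n u m < \<infinity> \<and>
      \<bar>(\<Prod>i\<in>I. enn2real (cell_mass \<alpha> n (u i) (m i))) * ?a M - enn2real (cell_integral I \<alpha> n u m)\<bar>
        \<le> C * ((\<Prod>i\<in>I. ?a (m i)) * (?a M / (real M + 1)))"
    using cell_integral_estimate[OF I \<alpha>] by blast
  \<comment> \<open>\<open>K\<close> times the ratio dominates both the ratio and the cell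
    mass.\<close>
  define K where "K = 2 + 1 / (\<alpha> * Gamma \<alpha>)"
  have K: "K \<ge> 2" unfolding K_def using Gamma_real_pos[of \<alpha>] \<alpha> by simp
  have apos: "?a p > 0" for p using \<alpha> by (intro rising_ratio_pos) auto
  \<comment> \<open>\<open>K + 1\<close> is the constant of
    \<open>rising_ratio_cell_mass_diff\<close>; the power covers the other factors.\<close>
  define D where "D = (K + 1) * K ^ card I"
  have D: "D \<ge> 0" unfolding D_def using K by simp
  show thesis
  proof (rule that[of "C + D"])
    show "C + D \<ge> 0" using C D by simp
  next
    fix n u m M
    assume n: "n = sum m I + M" "n > card I" and u: "(\<Sum>i\<in>I. u i) \<le> (1::real)"
      and m: "\<And>i. i \<in> I \<Longrightarrow> real (m i) \<le> real n * u i"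
    have n0: "n > 0" using n(2) by simp
    define B where "B i = enn2real (cell_mass \<alpha> n (u i) (m i))" for i
    define A where "A = (\<Prod>i\<in>I. ?a (m i))"
    define E where "E = (\<Sum>i\<in>I. cell_error n (u i) (m i))"
    define J where "J = enn2real (cell_integral I \<alpha> n u m)"
    have A: "A \<ge> 0" unfolding A_def by (intro prod_nonneg) (auto intro: less_imp_le apos)
    have E: "E \<ge> 0" unfolding E_def by (intro sum_nonneg cell_error_nonneg)
    have "\<bar>A - prod B I\<bar> \<le> (\<Sum>i\<in>I. \<bar>?a (m i) - B i\<bar> * (\<Prod>l\<in>I - {i}. K * ?a (m l)))"
      unfolding A_def
    proof (rule abs_prod_diff_le[OF I])
      fix i
      have "1 * ?a (m i) \<le> K * ?a (m i)" using K apos[of "m i"] by (intro mult_right_mono) auto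
      then show "\<bar>?a (m i)\<bar> \<le> K * ?a (m i)" using apos[of "m i"] by simp
      show "\<bar>B i\<bar> \<le> K * ?a (m i)"
        using cell_mass_real(2)[OF n0 \<alpha>] by (simp add: B_def K_def)
    qed
    also have "\<dots> \<le> (\<Sum>i\<in>I. D * A * cell_error n (u i) (m i))"
    proof (rule sum_mono)
      fix i assume i: "i \<in> I"
      have diff: "\<bar>?a (m i) - B i\<bar> \<le> (K + 1) * (?a (m i) * cell_error n (u i) (m i))"
        using rising_ratio_cell_mass_diff[OF n0 \<alpha> m[OF i]]
        by (simp add: B_def K_def cell_error_def)
      have "(\<Prod>l\<in>I - {i}. K * ?a (m l)) = K ^ (card I - 1) * (\<Prod>l\<in>I - {i}. ?a (m l))"
        using I i by (simp add: prod.distrib)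
      also have "\<dots> \<le> K ^ card I * (\<Prod>l\<in>I - {i}. ?a (m l))"
        using K by (intro mult_right_mono power_increasing prod_nonneg) (auto intro: less_imp_le apos)
      finally have "\<bar>?a (m i) - B i\<bar> * (\<Prod>l\<in>I - {i}. K * ?a (m l))
          \<le> ((K + 1) * (?a (m i) * cell_error n (u i) (m i))) * (K ^ card I * (\<Prod>l\<in>I - {i}. ?a (m l)))"
        using diff K apos cell_error_nonneg[of n "u i" "m i"]
        by (intro mult_mono) (auto intro!: prod_nonneg mult_nonneg_nonneg less_imp_le[OF apos])
      also have "\<dots> = D * A * cell_error n (u i) (m i)"
        unfolding A_def prod.remove[OF I i] D_def by (simp add: mult_ac)
      finally show "\<bar>?a (m i) - B i\<bar> * (\<Prod>l\<in>I - {i}. K * ?a (m l)) \<le> D * A * cell_error n (u i) (m i)" .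
    qed
    also have "\<dots> = D * A * E" by (simp add: E_def sum_distrib_left)
    finally have AB: "\<bar>A - prod B I\<bar> \<le> D * A * E" .
    have "\<bar>A * ?a M - J\<bar> \<le> \<bar>(A - prod B I) * ?a M\<bar> + \<bar>prod B I * ?a M - J\<bar>"
      by (simp add: algebra_simps)
    also have "\<dots> \<le> D * A * E * ?a M + C * (A * (?a M / (real M + 1)))"
    proof (rule add_mono)
      show "\<bar>(A - prod B I) * ?a M\<bar> \<le> D * A * E * ?a M"
        using AB apos[of M] by (simp add: abs_mult mult_right_mono)
      show "\<bar>prod B I * ?a M - J\<bar> \<le> C * (A * (?a M / (real M + 1)))"
        using est[OF n u] by (simp add: A_def B_def J_def)
    qed
    also have "\<dots> \<le> (C + D) * (A * ?a M * E) + (C + D) * (A * ?a M * (1 / (real M + 1)))"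
    proof (rule add_mono)
      have "D * (A * ?a M * E) \<le> (C + D) * (A * ?a M * E)"
        using C D A E apos[of M] by (intro mult_right_mono) auto
      then show "D * A * E * ?a M \<le> (C + D) * (A * ?a M * E)" by (simp add: mult_ac)
      have "C * (A * ?a M * (1 / (real M + 1))) \<le> (C + D) * (A * ?a M * (1 / (real M + 1)))"
        using C D A apos[of M] by (intro mult_right_mono) auto
      then show "C * (A * (?a M / (real M + 1))) \<le> (C + D) * (A * ?a M * (1 / (real M + 1)))" by simp
    qed
    also have "\<dots> = (C + D) * (A * ?a M * (E + 1 / (real M + 1)))" by (simp only: distrib_left)
    finally show "cell_integral I \<alpha> n u m < \<infinity> \<and>
      \<bar>(\<Prod>i\<in>I. ?a (m i)) * ?a M - enn2real (cell_integral I \<alpha> n u m)\<bar>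
        \<le> (C + D) * ((\<Prod>i\<in>I. ?a (m i)) * ?a M * ((\<Sum>i\<in>I. cell_error n (u i) (m i)) + 1 / (real M + 1)))"
      using est[OF n u] unfolding A_def E_def J_def by blast
  qed
qed

text \<open>Single out coordinate \<open>i\<close>. By Vandermonde the others sum to
  \<open>rising_ratio (1 - \<alpha>) (n - p)\<close>, which leaves the two quantities of
  \<open>rising_ratio_product_bound\<close>.\<close>

lemma sum_compositions_cell_error:
  assumes \<alpha>: "0 < \<alpha>" "\<alpha> \<le> 1/2"
  obtains D where "D \<ge> 0" and "\<And>(I :: 'i set) i n v. \<lbrakk>finite I; i \<in> I; real (card I) * \<alpha> = 1\<rbrakk> \<Longrightarrow>
    (\<Sum>m\<in>compositions I n. (\<Prod>l\<in>I. rising_ratio \<alpha> (m l)) * cell_error n v (m i))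
      \<le> D * (real n + 1) powr (-\<alpha>)"
proof -
  let ?a = "rising_ratio \<alpha>"
  obtain C where C: "C \<ge> 0" and C1: "\<And>n p. p \<le> n \<Longrightarrow>
      ?a p * rising_ratio (1 - \<alpha>) (n - p) \<le> C * (real n + 1) powr (-\<alpha>)"
    and C2: "\<And>n. (\<Sum>p\<le>n. ?a p / (real p + 1) * rising_ratio (1 - \<alpha>) (n - p)) \<le> C * (real n + 1) powr (-\<alpha>)"
    using rising_ratio_product_bound[OF \<alpha>] by blast
  show thesis
  proof (rule that[of "2 * C"])
    show "2 * C \<ge> 0" using C by simp
  next
    fix I :: "'i set" and i n v
    assume I: "finite I" "i \<in> I" and card: "real (card I) * \<alpha> = 1"
    define J where "J = I - {i}"
    have J: "finite J" "i \<notin> J" "I = insert i J" using I by (auto simp: J_def)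
    have cJ: "real (card J) * \<alpha> = 1 - \<alpha>" using card J by (simp add: algebra_simps)
    define N where "N = nat \<lfloor>real n * v\<rfloor>"
    have "(\<Sum>m\<in>compositions I n. (\<Prod>l\<in>I. ?a (m l)) * cell_error n v (m i))
        = (\<Sum>p\<le>n. \<Sum>m\<in>compositions J (n - p). (?a p * cell_error n v p) * (\<Prod>l\<in>J. ?a (m l)))"
      unfolding J(3) using J(1,2)
      by (simp add: sum_compositions_insert prod_fun_upd_other[where g = "\<lambda>_. ?a"] mult_ac)
    also have "\<dots> = (\<Sum>p\<le>n. (?a p * cell_error n v p) * rising_ratio (1 - \<alpha>) (n - p))"
      by (simp only: sum_distrib_left[symmetric] sum_compositions_rising_ratio[OF J(1)] cJ)
    \<comment> \<open>The indicator in \<open>cell_error\<close> leaves the single term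
      \<open>p = N\<close>, or nothing if \<open>N > n\<close>.\<close>
    also have "\<dots> = (\<Sum>p\<le>n. ?a p / (real p + 1) * rising_ratio (1 - \<alpha>) (n - p))
        + (\<Sum>p\<le>n. if p = N then ?a p * rising_ratio (1 - \<alpha>) (n - p) else 0)"
      unfolding sum.distrib[symmetric]
      by (intro sum.cong) (auto simp: cell_error_def N_def distrib_left distrib_right)
    also have "\<dots> \<le> C * (real n + 1) powr (-\<alpha>) + C * (real n + 1) powr (-\<alpha>)"
      using C C1 by (intro add_mono C2) auto
    finally show "(\<Sum>m\<in>compositions I n. (\<Prod>l\<in>I. ?a (m l)) * cell_error n v (m i))
        \<le> 2 * C * (real n + 1) powr (-\<alpha>)" by simp
  qed
qed

subsection \<open>Comparison of the distribution functions\<close>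

text \<open>For \<open>t\<close> in \<open>[0, v]\<close> exactly one cell contributes, the one with
  \<open>p = nat \<lfloor>real n * t\<rfloor>\<close>.\<close>

lemma sum_cell_density:
  assumes "n > 0"
  shows "(\<Sum>p\<le>nat \<lfloor>real n * v\<rfloor>. cell_density \<alpha> n v p t)
       = indicator {0..v} t * ennreal (real n * power_density \<alpha> (real n * t))"
proof (cases "0 \<le> t \<and> t \<le> v")
  case True
  define q where "q = nat \<lfloor>real n * t\<rfloor>"
  have "real n * t \<le> real n * v" using True by (intro mult_left_mono) auto
  then have q: "q \<le> nat \<lfloor>real n * v\<rfloor>" unfolding q_def by (intro nat_mono floor_mono)
  have "t \<in> cell n v p \<longleftrightarrow> p = q" for p
  proof -
    have "real n * t \<ge> 0" using True by simp
    then have "real p \<le> real n * t \<and> real n * t < real p + 1 \<longleftrightarrow> p = q"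
      unfolding q_def by linarith
    then show ?thesis using True by (auto simp: cell_def)
  qed
  then have "(\<Sum>p\<le>nat \<lfloor>real n * v\<rfloor>. cell_density \<alpha> n v p t)
      = (\<Sum>p\<le>nat \<lfloor>real n * v\<rfloor>. if p = q then ennreal (real n * power_density \<alpha> (real n * t)) else 0)"
    by (intro sum.cong) (auto simp: cell_density_def)
  also have "\<dots> = ennreal (real n * power_density \<alpha> (real n * t))" using q by simp
  finally show ?thesis using True by simp
next
  case False
  have "t \<notin> cell n v p" for p
  proof
    assume "t \<in> cell n v p"
    then have "t \<le> v" "0 \<le> real n * t" by (auto simp: cell_def intro: order_trans[OF of_nat_0_le_iff])
    then show False using False assms by (simp add: zero_le_mult_iff)
  qed
  then show ?thesis using False by (auto simp: cell_density_def)
qed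

lemma power_density_scaled:
  assumes "n > 0" "0 \<le> t"
  shows "power_density \<alpha> (real n * t) = real n powr (\<alpha> - 1) * (t powr (\<alpha> - 1) / Gamma \<alpha>)"
  using assms by (simp add: power_density_def powr_mult)

text \<open>Multiplying out the one-dimensional tilings gives the sum over \<open>m\<close>. The
  powers of \<open>n\<close> cancel: \<open>k - 1\<close> factors have exponent
  \<open>\<alpha>\<close> and the last has \<open>\<alpha> - 1\<close>, in total
  \<open>k * \<alpha> - 1 = 0\<close>.\<close>

lemma dirichlet_density_cells:
  fixes k n :: nat
  assumes k: "k \<ge> 2" and n: "n > 0" and u: "(\<Sum>i\<in>{1..<k}. u i) \<le> 1"
    and t: "t \<in> space (\<Pi>\<^sub>M i\<in>{1..<k}. lborel)"
  defines "\<alpha> \<equiv> 1 / real k"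
  shows "ennreal (1 / Gamma \<alpha> ^ k * (indicator (\<Pi>\<^sub>E i\<in>{1..<k}. {0..u i}) t *
           ((\<Prod>i\<in>{1..<k}. t i powr (\<alpha> - 1)) * (1 - (\<Sum>i\<in>{1..<k}. t i)) powr (\<alpha> - 1))))
       = (\<Sum>m\<in>(\<Pi>\<^sub>E i\<in>{1..<k}. {..nat \<lfloor>real n * u i\<rfloor>}).
           (\<Prod>i\<in>{1..<k}. cell_density \<alpha> n (u i) (m i) (t i)) *
           ennreal (power_density \<alpha> (real n * (1 - (\<Sum>i\<in>{1..<k}. t i)))))"
proof -
  let ?I = "{1..<k}"
  let ?q = "ennreal (power_density \<alpha> (real n * (1 - (\<Sum>i\<in>?I. t i))))"
  have \<alpha>: "0 < \<alpha>" using k by (simp add: \<alpha>_def)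
  have G: "Gamma \<alpha> > 0" using \<alpha> by (simp add: Gamma_real_pos)
  have "(\<Sum>m\<in>(\<Pi>\<^sub>E i\<in>?I. {..nat \<lfloor>real n * u i\<rfloor>}). (\<Prod>i\<in>?I. cell_density \<alpha> n (u i) (m i) (t i)) * ?q)
      = (\<Prod>i\<in>?I. \<Sum>p\<le>nat \<lfloor>real n * u i\<rfloor>. cell_density \<alpha> n (u i) p (t i)) * ?q"
    by (subst prod_sum_PiE) (auto simp: sum_distrib_right)
  also have "\<dots> = (\<Prod>i\<in>?I. indicator {0..u i} (t i) * ennreal (real n * power_density \<alpha> (real n * t i))) * ?q"
    by (simp only: sum_cell_density[OF n])
  also have "\<dots> = ennreal (1 / Gamma \<alpha> ^ k * (indicator (\<Pi>\<^sub>E i\<in>?I. {0..u i}) t *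
           ((\<Prod>i\<in>?I. t i powr (\<alpha> - 1)) * (1 - (\<Sum>i\<in>?I. t i)) powr (\<alpha> - 1))))"
  proof (cases "t \<in> (\<Pi>\<^sub>E i\<in>?I. {0..u i})")
    case True
    then have ti: "0 \<le> t i" "t i \<le> u i" if "i \<in> ?I" for i using that by (auto simp: PiE_iff)
    have "(\<Sum>i\<in>?I. t i) \<le> (\<Sum>i\<in>?I. u i)" using ti by (intro sum_mono) auto
    then have s: "0 \<le> 1 - (\<Sum>i\<in>?I. t i)" using u by linarith
    define c where "c = real n * real n powr (\<alpha> - 1) / Gamma \<alpha>"
    have c: "c = real n powr \<alpha> / Gamma \<alpha>" unfolding c_def using n by (simp add: powr_mult_base)
    have "(\<Prod>i\<in>?I. indicator {0..u i} (t i) * ennreal (real n * power_density \<alpha> (real n * t i)))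
        = (\<Prod>i\<in>?I. ennreal (c * t i powr (\<alpha> - 1)))"
      using ti n by (intro prod.cong) (auto simp: power_density_scaled c_def mult_ac)
    also have "\<dots> = ennreal (\<Prod>i\<in>?I. c * t i powr (\<alpha> - 1))"
      using G by (intro prod_ennreal) (auto simp: c)
    also have "(\<Prod>i\<in>?I. c * t i powr (\<alpha> - 1)) = c ^ (k - 1) * (\<Prod>i\<in>?I. t i powr (\<alpha> - 1))"
      by (simp add: prod.distrib)
    finally have "(\<Prod>i\<in>?I. indicator {0..u i} (t i) * ennreal (real n * power_density \<alpha> (real n * t i))) * ?q
        = ennreal (c ^ (k - 1) * (\<Prod>i\<in>?I. t i powr (\<alpha> - 1))) * ?q" by simp
    also have "\<dots> = ennreal (c ^ (k - 1) * (\<Prod>i\<in>?I. t i powr (\<alpha> - 1)) *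
        power_density \<alpha> (real n * (1 - (\<Sum>i\<in>?I. t i))))"
      using G \<alpha> by (intro ennreal_mult[symmetric] mult_nonneg_nonneg power_density_nonneg prod_nonneg)
        (auto simp: c)
    also have "c ^ (k - 1) * (\<Prod>i\<in>?I. t i powr (\<alpha> - 1)) * power_density \<alpha> (real n * (1 - (\<Sum>i\<in>?I. t i)))
        = (c ^ (k - 1) * (real n powr (\<alpha> - 1) / Gamma \<alpha>)) *
          ((\<Prod>i\<in>?I. t i powr (\<alpha> - 1)) * (1 - (\<Sum>i\<in>?I. t i)) powr (\<alpha> - 1))"
      unfolding power_density_scaled[OF n s] by (simp add: mult_ac)
    also have "c ^ (k - 1) * (real n powr (\<alpha> - 1) / Gamma \<alpha>) = 1 / Gamma \<alpha> ^ k"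
    proof -
      have "(real n powr \<alpha>) ^ (k - 1) * real n powr (\<alpha> - 1) = real n powr (real (k - 1) * \<alpha> + (\<alpha> - 1))"
        using n by (simp add: powr_add powr_realpow[symmetric] powr_powr mult.commute)
      also have "real (k - 1) * \<alpha> + (\<alpha> - 1) = 0"
        using k by (simp add: \<alpha>_def field_simps of_nat_diff)
      finally have "(real n powr \<alpha>) ^ (k - 1) * real n powr (\<alpha> - 1) = 1" using n by simp
      moreover have "Gamma \<alpha> ^ k = Gamma \<alpha> ^ (k - 1) * Gamma \<alpha>"
        using k by (metis power_minus_mult One_nat_def Suc_1 Suc_le_lessD zero_less_Suc less_le_trans pos2)
      ultimately show ?thesis unfolding c by (simp add: power_divide)
    qed
    finally show ?thesis using True by simp
  next
    case False
    \<comment> \<open>\<open>t\<close> is extensional, so it can leave the box only through a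
      coordinate outside its interval.\<close>
    then obtain i where i: "i \<in> ?I" "t i \<notin> {0..u i}"
      using t by (auto simp: PiE_iff space_PiM)
    then have "(\<Prod>i\<in>?I. indicator {0..u i} (t i) * ennreal (real n * power_density \<alpha> (real n * t i))) = 0"
      by (intro prod_zero) (auto intro!: bexI[of _ i] simp: indicator_def)
    then show ?thesis using False by simp
  qed
  finally show ?thesis ..
qed

text \<open>The integrand is nonnegative, so its integral is \<open>enn2real\<close> of the
  nonnegative integral; the latter splits over the cells.\<close>

lemma dirichlet_cdf_cells:
  fixes k n :: nat
  assumes k: "k \<ge> 2" and n: "n > 0" and u: "(\<Sum>i\<in>{1..<k}. u i) \<le> 1"
  shows "dirichlet_cdf k u = enn2real (\<Sum>m\<in>(\<Pi>\<^sub>E i\<in>{1..<k}. {..nat \<lfloor>real n * u i\<rfloor>}).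
           cell_integral {1..<k} (1 / real k) n u m)"
proof -
  let ?I = "{1..<k}" and ?\<alpha> = "1 / real k"
  let ?M = "\<Pi>\<^sub>M i\<in>?I. lborel :: real measure"
  let ?L = "\<Pi>\<^sub>E i\<in>?I. {..nat \<lfloor>real n * u i\<rfloor>}"
  let ?g = "\<lambda>t. 1 / Gamma ?\<alpha> ^ k * (indicator (\<Pi>\<^sub>E i\<in>?I. {0..u i}) t *
      ((\<Prod>i\<in>?I. t i powr (?\<alpha> - 1)) * (1 - (\<Sum>i\<in>?I. t i)) powr (?\<alpha> - 1)))"
  let ?F = "\<lambda>m t. (\<Prod>i\<in>?I. cell_density ?\<alpha> n (u i) (m i) (t i)) *
      ennreal (power_density ?\<alpha> (real n * (1 - (\<Sum>i\<in>?I. t i))))"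
  have G: "Gamma ?\<alpha> > 0" using k by (simp add: Gamma_real_pos)
  have box: "(\<Pi>\<^sub>E i\<in>?I. {0..u i}) \<in> sets ?M" by (intro sets_PiM_I_finite) auto
  have gm: "?g \<in> borel_measurable ?M"
    by (intro borel_measurable_times borel_measurable_const borel_measurable_indicator box) measurable
  have "dirichlet_cdf k u = (LINT t|?M. ?g t)"
    unfolding dirichlet_cdf_def set_lebesgue_integral_def real_scaleR_def
    by (rule integral_mult_right_zero[symmetric])
  also have "\<dots> = enn2real (\<integral>\<^sup>+ t. ennreal (?g t) \<partial>?M)"
    using gm G by (intro integral_eq_nn_integral AE_I2 mult_nonneg_nonneg prod_nonneg) auto
  also have "(\<integral>\<^sup>+ t. ennreal (?g t) \<partial>?M) = (\<integral>\<^sup>+ t. (\<Sum>m\<in>?L. ?F m t) \<partial>?M)"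
    by (intro nn_integral_cong dirichlet_density_cells[OF k n u])
  also have "\<dots> = (\<Sum>m\<in>?L. cell_integral ?I ?\<alpha> n u m)"
    unfolding cell_integral_def by (intro nn_integral_sum) measurable
  finally show ?thesis .
qed

section \<open>The combinatorial distribution function and the final comparison\<close>

text \<open>Matches the cells of the box with the admissible compositions. The last part is
  determined by the others, and \<open>(\<Sum>i\<in>{1..<k}. u i) \<le> 1\<close> ensures that the
  natural subtraction is exact.\<close>

lemma sum_bounded_compositions:
  fixes G :: "(nat \<Rightarrow> nat) \<Rightarrow> real"
  assumes k: "k \<ge> 1" and u: "\<forall>i\<in>{1..<k}. u i \<ge> 0" "(\<Sum>i\<in>{1..<k}. u i) \<le> 1"
  shows "(\<Sum>m\<in>(\<Pi>\<^sub>E i\<in>{1..<k}. {..nat \<lfloor>real n * u i\<rfloor>}). G (m(k := n - sum m {1..<k})))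
       = (\<Sum>m | m \<in> compositions {1..k} n \<and> (\<forall>i\<in>{1..<k}. real (m i) \<le> real n * u i). G m)"
    and "m \<in> (\<Pi>\<^sub>E i\<in>{1..<k}. {..nat \<lfloor>real n * u i\<rfloor>}) \<Longrightarrow> i \<in> {1..<k} \<Longrightarrow> real (m i) \<le> real n * u i"
    and "m \<in> (\<Pi>\<^sub>E i\<in>{1..<k}. {..nat \<lfloor>real n * u i\<rfloor>}) \<Longrightarrow> sum m {1..<k} \<le> n"
proof -
  let ?I = "{1..<k}"
  let ?L = "\<Pi>\<^sub>E i\<in>?I. {..nat \<lfloor>real n * u i\<rfloor>}"
  have I: "{1..k} = insert k ?I" "k \<notin> ?I" using k by auto
  have le_iff: "p \<le> nat \<lfloor>real n * u i\<rfloor> \<longleftrightarrow> real p \<le> real n * u i" if "i \<in> ?I" for i p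
  proof -
    have "real n * u i \<ge> 0" using u that by simp
    then show ?thesis by linarith
  qed
  have mle: "real (m i) \<le> real n * u i" if "m \<in> ?L" "i \<in> ?I" for m i
    using that le_iff by (auto simp: PiE_iff)
  have suml: "sum m ?I \<le> n" if "m \<in> ?L" for m
  proof -
    have "real (sum m ?I) \<le> (\<Sum>i\<in>?I. real n * u i)"
      unfolding of_nat_sum using mle[OF that] by (intro sum_mono) auto
    also have "\<dots> \<le> real n * 1" unfolding sum_distrib_left[symmetric] using u by (intro mult_left_mono) auto
    finally show ?thesis by (simp only: mult_1_right of_nat_le_iff)
  qed
  have upd: "sum (m(k := p)) ?I = sum m ?I" for m :: "nat \<Rightarrow> nat" and p
    by (intro sum.cong) auto
  have sumk: "sum m {1..k} = m k + sum m ?I" for m :: "nat \<Rightarrow> nat"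
    unfolding I(1) using I(2) by simp
  show "(\<Sum>m\<in>?L. G (m(k := n - sum m ?I)))
       = (\<Sum>m | m \<in> compositions {1..k} n \<and> (\<forall>i\<in>?I. real (m i) \<le> real n * u i). G m)"
  proof (rule sum.reindex_bij_witness[where j = "\<lambda>m. m(k := n - sum m ?I)" and i = "\<lambda>m. m(k := undefined)"])
    fix m assume m: "m \<in> ?L"
    show "m(k := n - sum m ?I) \<in> {m. m \<in> compositions {1..k} n \<and> (\<forall>i\<in>?I. real (m i) \<le> real n * u i)}"
    proof -
      have "sum (m(k := n - sum m ?I)) {1..k} = n" unfolding sumk upd using suml[OF m] by simp
      moreover have "m(k := n - sum m ?I) \<in> {1..k} \<rightarrow>\<^sub>E UNIV"
        using m k by (auto simp: PiE_iff extensional_def)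
      ultimately show ?thesis using mle[OF m] by (simp add: compositions_def)
    qed
    show "(m(k := n - sum m ?I))(k := undefined) = m"
      using m by (auto simp: PiE_iff extensional_def fun_eq_iff)
  next
    fix m assume m: "m \<in> {m. m \<in> compositions {1..k} n \<and> (\<forall>i\<in>?I. real (m i) \<le> real n * u i)}"
    have "sum m {1..k} = n" using m by (simp add: compositions_def)
    then have "m k = n - sum m ?I" using sumk[of m] by linarith
    then show "(m(k := undefined))(k := n - sum (m(k := undefined)) ?I) = m"
      unfolding upd fun_upd_upd by (metis fun_upd_triv)
    show "m(k := undefined) \<in> ?L"
      using m le_iff by (auto simp: compositions_def PiE_iff extensional_def)
  qed simp
  show "m \<in> ?L \<Longrightarrow> i \<in> ?I \<Longrightarrow> real (m i) \<le> real n * u i" by (rule mle)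
  show "m \<in> ?L \<Longrightarrow> sum m ?I \<le> n" by (rule suml)
qed

text \<open>The distribution function of the Dirichlet-multinomial law with \<open>k\<close>
  parameters \<open>1 / k\<close>, the discrete counterpart of \<open>dirichlet_cdf\<close>.\<close>

definition composition_cdf :: "nat \<Rightarrow> nat \<Rightarrow> (nat \<Rightarrow> real) \<Rightarrow> real" where
  "composition_cdf k n u = (\<Sum>m | m \<in> compositions {1..k} n \<and> (\<forall>i\<in>{1..<k}. real (m i) \<le> real n * u i).
     \<Prod>i\<in>{1..k}. rising_ratio (1 / real k) (m i))"

lemma invariant_tuples_average_eq_composition_cdf:
  "1 / fact n * (\<Sum>\<sigma> | \<sigma> permutes {1..n}.
      1 / real (tau k n \<sigma>) * real (card (invariant_tuples k n u \<sigma>))) = composition_cdf k n u"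
proof -
  let ?ok = "\<lambda>m. \<forall>i\<in>{1..<k}. real (m i) \<le> real n * u i"
  have "(\<Prod>i\<in>{1..k}. if i < k \<and> real (m i) > real n * u i then 0 else rising_ratio (1 / real k) (m i))
      = (if ?ok m then \<Prod>i\<in>{1..k}. rising_ratio (1 / real k) (m i) else 0)" for m
  proof (cases "?ok m")
    case True
    then show ?thesis by (auto intro!: prod.cong simp: not_less[symmetric])
  next
    case False
    then obtain i where "i \<in> {1..<k}" "real (m i) > real n * u i" by (auto simp: not_le)
    then have "(\<Prod>i\<in>{1..k}. if i < k \<and> real (m i) > real n * u i then 0 else rising_ratio (1 / real k) (m i)) = 0"
      by (intro prod_zero) (auto intro!: bexI[of _ i])
    then show ?thesis unfolding if_not_P[OF False] .
  qed
  then show ?thesis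
    unfolding invariant_tuples_average composition_cdf_def
    by (simp add: sum.inter_filter[OF finite_compositions, symmetric])
qed

text \<open>The weights of all compositions add up to \<open>rising_ratio 1 n = 1\<close>.\<close>

lemma composition_cdf_bounds:
  assumes "k \<ge> 1"
  shows "0 \<le> composition_cdf k n u" "composition_cdf k n u \<le> 1"
proof -
  have pos: "(\<Prod>i\<in>{1..k}. rising_ratio (1 / real k) (m i)) \<ge> 0" for m
    using assms by (intro prod_nonneg) (auto intro!: less_imp_le[OF rising_ratio_pos])
  then show "0 \<le> composition_cdf k n u" unfolding composition_cdf_def by (intro sum_nonneg)
  have "composition_cdf k n u \<le> (\<Sum>m\<in>compositions {1..k} n. \<Prod>i\<in>{1..k}. rising_ratio (1 / real k) (m i))"
    unfolding composition_cdf_def using pos by (intro sum_mono2) (auto simp: finite_compositions)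
  also have "\<dots> = 1" using assms by (subst sum_compositions_rising_ratio) auto
  finally show "composition_cdf k n u \<le> 1" .
qed

text \<open>Both functions are sums over the same cells, so the cellwise errors add up.
  \<open>n \<ge> k\<close> makes \<open>n\<close> exceed the number \<open>k - 1\<close> of free
  coordinates.\<close>

lemma composition_cdf_large:
  assumes k: "k \<ge> 2"
  obtains C where "C \<ge> 0" and "\<And>n u. \<lbrakk>n \<ge> k; \<And>i. i \<in> {1..<k} \<Longrightarrow> u i \<ge> 0; (\<Sum>i\<in>{1..<k}. u i) \<le> 1\<rbrakk> \<Longrightarrow>
    \<bar>composition_cdf k n u - dirichlet_cdf k u\<bar> \<le> C * real n powr (- (1 / real k))"
proof -
  define \<alpha> where "\<alpha> = 1 / real k"
  let ?I = "{1..<k}" and ?a = "rising_ratio \<alpha>"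
  have \<alpha>: "0 < \<alpha>" "\<alpha> \<le> 1" "\<alpha> \<le> 1/2" using k by (auto simp: \<alpha>_def field_simps)
  obtain C where C: "C \<ge> 0" and est: "\<And>n u m M.
      \<lbrakk>n = sum m ?I + M; n > card ?I; (\<Sum>i\<in>?I. u i) \<le> 1; \<And>i. i \<in> ?I \<Longrightarrow> real (m i) \<le> real n * u i\<rbrakk> \<Longrightarrow>
      cell_integral ?I \<alpha> n u m < \<infinity> \<and>
      \<bar>(\<Prod>i\<in>?I. ?a (m i)) * ?a M - enn2real (cell_integral ?I \<alpha> n u m)\<bar>
        \<le> C * ((\<Prod>i\<in>?I. ?a (m i)) * ?a M *
                ((\<Sum>i\<in>?I. cell_error n (u i) (m i)) + 1 / (real M + 1)))"
    using rising_ratio_cell_integral_diff[of ?I, OF _ \<alpha>(1,2)] by blast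
  obtain D where D: "D \<ge> 0" and err: "\<And>(I :: nat set) i n v. \<lbrakk>finite I; i \<in> I; real (card I) * \<alpha> = 1\<rbrakk> \<Longrightarrow>
      (\<Sum>m\<in>compositions I n. (\<Prod>l\<in>I. ?a (m l)) * cell_error n v (m i)) \<le> D * (real n + 1) powr (-\<alpha>)"
    using sum_compositions_cell_error[OF \<alpha>(1,3)] by blast
  have apos: "?a p > 0" for p using \<alpha> by (intro rising_ratio_pos) auto
  have I: "{1..k} = insert k ?I" "k \<notin> ?I" using k by auto
  show thesis
  proof (rule that[of "C * (real k * D)"])
    show "C * (real k * D) \<ge> 0" using C D by simp
  next
    fix n u
    assume n: "n \<ge> k" and u: "\<And>i. i \<in> ?I \<Longrightarrow> u i \<ge> 0" "(\<Sum>i\<in>?I. u i) \<le> (1::real)"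
    have n0: "n > 0" using n k by simp
    let ?L = "\<Pi>\<^sub>E i\<in>?I. {..nat \<lfloor>real n * u i\<rfloor>}"
    let ?J = "cell_integral ?I \<alpha> n u"
    define A where "A m = (\<Prod>i\<in>{1..k}. ?a (m i))" for m
    \<comment> \<open>Symmetric in all \<open>k\<close> coordinates: the error at \<open>k\<close>
      includes an indicator for the arbitrary value \<open>u k\<close>, which can only enlarge the
      bound.\<close>
    define H where "H m = A m * (\<Sum>i\<in>{1..k}. cell_error n (u i) (m i))" for m
    have k1: "k \<ge> 1" using k by simp
    have u': "\<forall>i\<in>?I. u i \<ge> 0" using u(1) by blast
    note bc = sum_bounded_compositions[where k = k and u = u and n = n, OF k1 u' u(2)]
    have A0: "A m \<ge> 0" for m unfolding A_def by (intro prod_nonneg) (auto intro: less_imp_le apos)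
    have H0: "H m \<ge> 0" for m unfolding H_def using A0 by (intro mult_nonneg_nonneg sum_nonneg cell_error_nonneg)
    have cell: "?J m < \<infinity> \<and>
        \<bar>A (m(k := n - sum m ?I)) - enn2real (?J m)\<bar> \<le> C * H (m(k := n - sum m ?I))" if m: "m \<in> ?L" for m
    proof -
      define M where "M = n - sum m ?I"
      have nM: "n = sum m ?I + M" using bc(3)[OF m] by (simp add: M_def)
      have nI: "n > card ?I" using n k by simp
      have AM: "A (m(k := M)) = (\<Prod>i\<in>?I. ?a (m i)) * ?a M"
        unfolding A_def I(1) using I(2)
        by (simp add: prod_fun_upd_other[where g = "\<lambda>_. ?a"] mult.commute)
      have EM: "(\<Sum>i\<in>{1..k}. cell_error n (u i) ((m(k := M)) i))
          = cell_error n (u k) M + (\<Sum>i\<in>?I. cell_error n (u i) (m i))"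
        unfolding I(1) using I(2) by simp
      have "\<bar>A (m(k := M)) - enn2real (?J m)\<bar>
          \<le> C * (A (m(k := M)) * ((\<Sum>i\<in>?I. cell_error n (u i) (m i)) + 1 / (real M + 1)))"
        using est[OF nM nI u(2) bc(2)[OF m]] unfolding AM by blast
      also have "\<dots> \<le> C * H (m(k := M))"
        unfolding H_def EM using C A0
        by (intro mult_left_mono) (auto simp: cell_error_def)
      finally show ?thesis using est[OF nM nI u(2) bc(2)[OF m]] by (simp add: M_def)
    qed
    have "dirichlet_cdf k u = enn2real (\<Sum>m\<in>?L. ?J m)"
      unfolding \<alpha>_def by (rule dirichlet_cdf_cells[OF k n0 u(2)])
    \<comment> \<open>All cell integrals are finite, so \<open>enn2real\<close> is additive
      here.\<close>
    also have "\<dots> = (\<Sum>m\<in>?L. enn2real (?J m))"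
    proof -
      have "(\<Sum>m\<in>?L. ?J m) = (\<Sum>m\<in>?L. ennreal (enn2real (?J m)))"
        using cell by (intro sum.cong) auto
      also have "\<dots> = ennreal (\<Sum>m\<in>?L. enn2real (?J m))" by (intro sum_ennreal) auto
      finally show ?thesis by (simp add: sum_nonneg)
    qed
    finally have F: "dirichlet_cdf k u = (\<Sum>m\<in>?L. enn2real (?J m))" .
    have T: "composition_cdf k n u = (\<Sum>m\<in>?L. A (m(k := n - sum m ?I)))"
      unfolding composition_cdf_def A_def \<alpha>_def by (rule bc(1)[symmetric])
    have "\<bar>composition_cdf k n u - dirichlet_cdf k u\<bar>
        \<le> (\<Sum>m\<in>?L. \<bar>A (m(k := n - sum m ?I)) - enn2real (?J m)\<bar>)"
      unfolding F T sum_subtractf[symmetric] by (rule sum_abs)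
    also have "\<dots> \<le> (\<Sum>m\<in>?L. C * H (m(k := n - sum m ?I)))"
      using cell by (intro sum_mono) auto
    also have "\<dots> = C * (\<Sum>m | m \<in> compositions {1..k} n \<and> (\<forall>i\<in>?I. real (m i) \<le> real n * u i). H m)"
      unfolding sum_distrib_left[symmetric] bc(1) ..
    \<comment> \<open>The terms are nonnegative, so the size restriction may be dropped; the errors
      are then summed one coordinate at a time over full compositions.\<close>
    also have "\<dots> \<le> C * (\<Sum>m\<in>compositions {1..k} n. H m)"
      using C H0 by (intro mult_left_mono sum_mono2) (auto simp: finite_compositions)
    also have "(\<Sum>m\<in>compositions {1..k} n. H m)
        = (\<Sum>i\<in>{1..k}. \<Sum>m\<in>compositions {1..k} n. A m * cell_error n (u i) (m i))"
      unfolding H_def sum_distrib_left by (rule sum.swap)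
    also have "C * \<dots> \<le> C * (\<Sum>i\<in>{1..k}. D * (real n + 1) powr (-\<alpha>))"
      unfolding A_def using C k by (intro mult_left_mono sum_mono err) (auto simp: \<alpha>_def)
    also have "\<dots> = C * (real k * D) * (real n + 1) powr (-\<alpha>)" by simp
    also have "\<dots> \<le> C * (real k * D) * real n powr (-\<alpha>)"
      using C D \<alpha> n0 by (intro mult_left_mono powr_mono2') auto
    finally show "\<bar>composition_cdf k n u - dirichlet_cdf k u\<bar> \<le> C * (real k * D) * real n powr (- (1 / real k))"
      by (simp add: \<alpha>_def)
  qed
qed

theorem theorem3:
  fixes k :: nat
  assumes "k \<ge> 2"
  shows "\<exists>C::real. \<forall>n::nat. \<forall>u::nat \<Rightarrow> real.
           n \<ge> 1 \<longrightarrow> (\<forall>i\<in>{1..<k}. u i \<ge> 0) \<longrightarrow> (\<Sum>i\<in>{1..<k}. u i) \<le> 1 \<longrightarrow>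
           \<bar>1 / fact n * (\<Sum>\<sigma> | \<sigma> permutes {1..n}.
                1 / real (tau k n \<sigma>) * real (card (invariant_tuples k n u \<sigma>)))
              - dirichlet_cdf k u\<bar> \<le> C * real n powr (- 1 / real k)"
proof -
  obtain C where C: "C \<ge> 0" and large: "\<And>n u. \<lbrakk>n \<ge> k; \<And>i. i \<in> {1..<k} \<Longrightarrow> u i \<ge> 0; (\<Sum>i\<in>{1..<k}. u i) \<le> 1\<rbrakk> \<Longrightarrow>
      \<bar>composition_cdf k n u - dirichlet_cdf k u\<bar> \<le> C * real n powr (- (1 / real k))"
    using composition_cdf_large[OF assms] by blast
  have k1: "k \<ge> 1" using assms by simp
  \<comment> \<open>For \<open>1 \<le> n < k\<close> the difference is at most
    \<open>1 + C * real k powr (- (1 / real k))\<close>, while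
    \<open>real n powr (- (1 / real k))\<close> is at least
    \<open>real k powr (- (1 / real k))\<close>.\<close>
  define D where "D = (1 + C * real k powr (- (1 / real k))) * real k powr (1 / real k)"
  have D: "D \<ge> 0" unfolding D_def using C by simp
  have bound: "\<bar>composition_cdf k n u - dirichlet_cdf k u\<bar> \<le> (C + D) * real n powr (- (1 / real k))"
    if n: "n \<ge> 1" and u: "\<And>i. i \<in> {1..<k} \<Longrightarrow> u i \<ge> 0" "(\<Sum>i\<in>{1..<k}. u i) \<le> 1" for n u
  proof (cases "n \<ge> k")
    case True
    have "C * real n powr (- (1 / real k)) \<le> (C + D) * real n powr (- (1 / real k))"
      using D by (intro mult_right_mono) auto
    then show ?thesis using large[OF True u] by linarith
  next
    case False
    \<comment> \<open>\<open>dirichlet_cdf k u\<close> does not depend on \<open>n\<close>, so the case \<open>n = k\<close> bounds it.\<close>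
    have "\<bar>composition_cdf k k u - dirichlet_cdf k u\<bar> \<le> C * real k powr (- (1 / real k))"
      using large[OF _ u, of k] by simp
    \<comment> \<open>Both values of \<open>composition_cdf\<close> lie in \<open>[0, 1]\<close>, so
      they differ by at most 1.\<close>
    then have "\<bar>composition_cdf k n u - dirichlet_cdf k u\<bar> \<le> 1 + C * real k powr (- (1 / real k))"
      using composition_cdf_bounds[OF k1, of k u] composition_cdf_bounds[OF k1, of n u] by linarith
    also have "\<dots> = (1 + C * real k powr (- (1 / real k))) * 1" by simp
    also have "\<dots> \<le> (1 + C * real k powr (- (1 / real k))) * (real k powr (1 / real k) * real n powr (- (1 / real k)))"
    proof (rule mult_left_mono)
      have "real n powr (1 / real k) \<le> real k powr (1 / real k)" using False by (intro powr_mono2) auto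
      then show "1 \<le> real k powr (1 / real k) * real n powr (- (1 / real k))"
        using n by (simp add: powr_minus field_simps)
    qed (use C in simp)
    also have "\<dots> = D * real n powr (- (1 / real k))" by (simp add: D_def)
    also have "\<dots> \<le> (C + D) * real n powr (- (1 / real k))"
      using C by (intro mult_right_mono) auto
    finally show ?thesis .
  qed
  show ?thesis
    unfolding invariant_tuples_average_eq_composition_cdf
    using bound by (intro exI[of _ "C + D"]) (auto simp: minus_divide_left[symmetric])
qed

end
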